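(* Let $X,Y$ be two triangulable spaces endowed with two continuous functions $\varphi:X\to\mathbb{R}$, $\psi:Y\to\mathbb{R}$. For each integer $k$, consider the $k$th persistent homology groups $H_k^{(X,\varphi)}$, $H_k^{(Y,\psi)}$ with homology coefficients in a field, and let $D_\varphi$ and $D_\psi$ be the (degree $k$) persistence diagrams associated with the filtering functions $\varphi$ and $\psi$, respectively. Then, for any integer $k$, $$d_T\left(H_k^{(X,\varphi)},H_k^{(Y,\psi)}\right)\le d_{match}(D_\varphi,D_\psi).$$
   Context: Triangulable means homeomorphic to the underlying space of a finite simplicial complex. Let $\Delta^+=\{(u,v)\in\mathbb{R}^2:u<v\}$ and $X\langle\varphi\le u\rangle=\{x\in X:\varphi(x)\le u\}$. $H_k$ denotes $k$th (singular) homology with coefficients in the fixed field. For $(u,v)\in\Delta^+$, the persistent homology group $H_k^{(X,\varphi)}(u,v)$ is the image of the homomorphism $H_k(X\langle\varphi\le u\rangle)\to H_k(X\langle\varphi\le v\rangle)$ induced by inclusion; $H_k^{(X,\varphi)}$ denotes the function $(u,v)\mapsto H_k^{(X,\varphi)}(u,v)$ on $\Delta^+$. Definition of $d_T$: let $E$ be the set of all real $\epsilon\ge 0$ such that for every $(u,v)\in\Delta^+$: (1) there is a surjective homomorphism from a subgroup of $H_k^{(X,\varphi)}(u,v)$ onto $H_k^{(Y,\psi)}(u-\epsilon,v+\epsilon)$; and (2) there is a surjective homomorphism from a subgroup of $H_k^{(Y,\psi)}(u,v)$ onto $H_k^{(X,\varphi)}(u-\epsilon,v+\epsilon)$. Then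 $d_T\left(H_k^{(X,\varphi)},H_k^{(Y,\psi)}\right)=\inf E$ if $E\ne\emptyset$, and $=\infty$ otherwise. Persistence diagram: let $\beta_\varphi(u,v)=\dim H_k^{(X,\varphi)}(u,v)$ for $(u,v)\in\Delta^+$ (this is finite). The multiplicity of a point $(u,v)\in\Delta^+$ is the minimum, over $\epsilon>0$ with $u+\epsilon<v-\epsilon$, of $\beta_\varphi(u+\epsilon,v-\epsilon)-\beta_\varphi(u-\epsilon,v-\epsilon)-\beta_\varphi(u+\epsilon,v+\epsilon)+\beta_\varphi(u-\epsilon,v+\epsilon)$; the multiplicity of a point $(u,\infty)$, $u\in\mathbb{R}$, is the minimum, over $\epsilon>0$ with $u+\epsilon<1/\epsilon$, of $\beta_\varphi(u+\epsilon,1/\epsilon)-\beta_\varphi(u-\epsilon,1/\epsilon)$. The persistence diagram $D_\varphi$ is the multiset of all points $(u,v)$ with $u<v\le\infty$ having positive multiplicity (counted with multiplicity), together with all points $(u,u)$, $u\in\mathbb{R}$, each counted with infinite multiplicity. $D_\psi$ is defined likewise from $\psi$. Matching distance: $d_{match}(D_\varphi,D_\psi)$ is the infimum, over all bijections (respecting multiplicities) $f:D_\varphi\to D_\psi$, of the cost of $f$, where the cost is the supremum over points $p\in D_\varphi$ of the displacement $\|p-f(p)\|_\infty$ (max-norm on the plane), with the conventions $\infty-\infty=0$ and $|\infty-a|=\infty$ for $a\in\mathbb{R}$. The value $\infty$ is allowed. *)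

theory Defs
  imports "HOL-Analysis.Analysis" "HOL-Homology.Homology" "Jordan_Normal_Form.VS_Connect"
begin

section \<open>Triangulable spaces\<close>

text \<open>The type parameter \<open>'e\<close> is the Euclidean space containing the simplicial complex; it is a free
  type variable wherever \<open>triangulable\<close> is assumed, so its dimension is arbitrary.\<close>

definition triangulable :: "'e::euclidean_space itself \<Rightarrow> 'a topology \<Rightarrow> bool" where
  "triangulable _ X \<longleftrightarrow>
     (\<exists>\<K> :: 'e set set. simplicial_complex \<K> \<and> X homeomorphic_space top_of_set (\<Union>\<K>))"


section \<open>Singular homology with coefficients in a field\<close>

text \<open>The chains of \<open>HOL-Homology\<close> have integer coefficients.  The definitions below are the same
  construction with coefficients in a field \<open>'f\<close>, on the same singular simplices and faces. The
  homology spaces are modules in the sense of \<open>HOL-Algebra\<close>, over the field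
  \<^term>\<open>class_ring\<close> of all elements of \<open>'f\<close>. The components \<^const>\<open>mult\<close> and \<^const>\<open>one\<close>, which these
  records inherit from rings, play no role.\<close>

type_synonym ('a, 'f) field_chain = "((nat \<Rightarrow> real) \<Rightarrow> 'a) \<Rightarrow>\<^sub>0 'f"

definition field_chain_space :: "int \<Rightarrow> 'a topology \<Rightarrow> ('f::field, ('a, 'f) field_chain) module" where
  "field_chain_space k X =
     \<lparr>carrier = {c. Poly_Mapping.keys c \<subseteq> (if k < 0 then {} else singular_simplex_set (nat k) X)},
      mult = undefined, one = undefined, zero = 0, add = (+),
      smult = (\<lambda>a. Poly_Mapping.map (\<lambda>b. a * b))\<rparr>"

definition field_boundary :: "int \<Rightarrow> ('a, 'f::field) field_chain \<Rightarrow> ('a, 'f) field_chain" where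
  "field_boundary k c =
     (if k \<le> 0 then 0
      else \<Sum>s \<in> Poly_Mapping.keys c. \<Sum>i\<le>nat k.
             Poly_Mapping.single (singular_face (nat k) i s) ((-1) ^ i * Poly_Mapping.lookup c s))"

definition field_cycle_space :: "int \<Rightarrow> 'a topology \<Rightarrow> ('f::field, ('a, 'f) field_chain) module" where
  "field_cycle_space k X =
     (field_chain_space k X)
       \<lparr>carrier := {c \<in> carrier (field_chain_space k X). field_boundary k c = 0}\<rparr>"

definition field_boundaries :: "int \<Rightarrow> 'a topology \<Rightarrow> ('a, 'f::field) field_chain set" where
  "field_boundaries k X = field_boundary (k + 1) ` carrier (field_chain_space (k + 1) X)"

text \<open>The union in the scalar multiplication is over representatives of a coset, which all
  give the same coset when \<open>B\<close> is a submodule of \<open>M\<close>.\<close>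

definition quotient_module :: "('f, 'c) module \<Rightarrow> 'c set \<Rightarrow> ('f, 'c set) module" where
  "quotient_module M B =
     \<lparr>carrier = a_rcosets\<^bsub>M\<^esub> B, mult = undefined, one = undefined, zero = B, add = set_add M,
      smult = (\<lambda>a A. \<Union>x\<in>A. B +>\<^bsub>M\<^esub> (a \<odot>\<^bsub>M\<^esub> x))\<rparr>"

definition field_homology :: "int \<Rightarrow> 'a topology \<Rightarrow> ('f::field, ('a, 'f) field_chain set) module" where
  "field_homology k X = quotient_module (field_cycle_space k X) (field_boundaries k X)"

text \<open>The map induced by the inclusion of \<open>X\<close>, a subspace of \<open>Y\<close>. Singular simplices of a subspace are
  singular simplices of the whole space on the nose, so on chains the inclusion induces the identity;
  the homology class of a cycle of \<open>X\<close> goes to the class in \<open>Y\<close> of the same cycle.\<close>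

definition homology_inclusion ::
  "int \<Rightarrow> 'a topology \<Rightarrow> ('a, 'f::field) field_chain set \<Rightarrow> ('a, 'f) field_chain set" where
  "homology_inclusion k Y A = (\<Union>z\<in>A. field_boundaries k Y +>\<^bsub>field_cycle_space k Y\<^esub> z)"


section \<open>Persistent homology groups\<close>

definition sublevel :: "'a topology \<Rightarrow> ('a \<Rightarrow> real) \<Rightarrow> real \<Rightarrow> 'a topology" where
  "sublevel X \<phi> u = subtopology X {x \<in> topspace X. \<phi> x \<le> u}"

text \<open>Only the values at \<open>u < v\<close> are used. The type parameter is the field of coefficients.\<close>

definition persistent_homology ::
  "'f::field itself \<Rightarrow> int \<Rightarrow> 'a topology \<Rightarrow> ('a \<Rightarrow> real) \<Rightarrow> real \<Rightarrow> real
    \<Rightarrow> ('f, ('a, 'f) field_chain set) module" where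
  "persistent_homology _ k X \<phi> u v =
     (field_homology k (sublevel X \<phi> v))
       \<lparr>carrier := homology_inclusion k (sublevel X \<phi> v) ` carrier (field_homology k (sublevel X \<phi> u))\<rparr>"

definition subgroup_surjects :: "('f, 'c) module \<Rightarrow> ('f, 'd) module \<Rightarrow> bool" where
  "subgroup_surjects G H \<longleftrightarrow>
     (\<exists>S f. subgroup S (add_monoid G) \<and> f \<in> epi ((add_monoid G)\<lparr>carrier := S\<rparr>) (add_monoid H))"

text \<open>The infimum of the empty set in \<^typ>\<open>ereal\<close> is \<open>\<infinity>\<close>.\<close>

definition d_T :: "(real \<Rightarrow> real \<Rightarrow> ('f, 'c) module) \<Rightarrow> (real \<Rightarrow> real \<Rightarrow> ('f, 'd) module) \<Rightarrow> ereal" where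
  "d_T H K =
     Inf (ereal ` {\<epsilon>. 0 \<le> \<epsilon> \<and>
       (\<forall>u v. u < v \<longrightarrow> subgroup_surjects (H u v) (K (u - \<epsilon>) (v + \<epsilon>))
                    \<and> subgroup_surjects (K u v) (H (u - \<epsilon>) (v + \<epsilon>)))})"


section \<open>Persistence diagrams and the matching distance\<close>

definition persistent_betti :: "(real \<Rightarrow> real \<Rightarrow> ('f::field, 'c) module) \<Rightarrow> real \<Rightarrow> real \<Rightarrow> nat" where
  "persistent_betti H u v = vectorspace.dim class_ring (H u v)"

definition multiplicity_at :: "(real \<Rightarrow> real \<Rightarrow> nat) \<Rightarrow> real \<Rightarrow> ereal \<Rightarrow> int" where
  "multiplicity_at \<beta> u v =
     (case v of
        ereal w \<Rightarrow> LEAST m. \<exists>\<epsilon>>0. u + \<epsilon> < w - \<epsilon> \<and>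
          m = int (\<beta> (u + \<epsilon>) (w - \<epsilon>)) - int (\<beta> (u - \<epsilon>) (w - \<epsilon>))
              - int (\<beta> (u + \<epsilon>) (w + \<epsilon>)) + int (\<beta> (u - \<epsilon>) (w + \<epsilon>))
      | PInfty \<Rightarrow> LEAST m. \<exists>\<epsilon>>0. u + \<epsilon> < 1 / \<epsilon> \<and>
          m = int (\<beta> (u + \<epsilon>) (1 / \<epsilon>)) - int (\<beta> (u - \<epsilon>) (1 / \<epsilon>))
      | MInfty \<Rightarrow> 0)"

text \<open>A multiset is encoded as the set of its numbered copies: a point of multiplicity \<open>m\<close> occurs as
  \<open>(p, 0), \<dots>, (p, m - 1)\<close>, a point of (countably) infinite multiplicity as \<open>(p, i)\<close> for all \<open>i\<close>.
  Bijections respecting multiplicities are then the bijections between these sets.\<close>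

type_synonym diagram = "((real \<times> ereal) \<times> nat) set"

definition persistence_diagram :: "(real \<Rightarrow> real \<Rightarrow> ('f::field, 'c) module) \<Rightarrow> diagram" where
  "persistence_diagram H =
     {((u, v), i). ereal u < v \<and> int i < multiplicity_at (persistent_betti H) u v}
     \<union> {((u, v), i). v = ereal u}"

text \<open>The case distinction gives \<open>\<infinity> - \<infinity> = 0\<close>, which is not the convention of \<^typ>\<open>ereal\<close>.\<close>

definition displacement :: "real \<times> ereal \<Rightarrow> real \<times> ereal \<Rightarrow> ereal" where
  "displacement p q =
     max (ereal \<bar>fst p - fst q\<bar>) (if snd p = snd q then 0 else \<bar>snd p - snd q\<bar>)"

definition d_match :: "diagram \<Rightarrow> diagram \<Rightarrow> ereal" where
  "d_match D E = (INF f \<in> {f. bij_betw f D E}. SUP p\<in>D. displacement (fst p) (fst (f p)))"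

end

theory Submission
  imports Defs
begin

text \<open>For \<open>u < v\<close>, the number of diagram points \<open>(a, b)\<close> with \<open>a < u\<close> and \<open>v < b\<close> is at most
  \<open>\<beta>(u, v)\<close>, and the number of those with \<open>a \<le> u\<close> and \<open>v \<le> b\<close> is at least \<open>\<beta>(u, v)\<close>. Both counts only use
  that \<open>\<beta>\<close> is monotone, nonnegative on rectangles, and zero for small \<open>u\<close>. A bijection of diagrams of cost less
  than \<open>\<epsilon>\<close> maps the second set at \<open>(u - \<epsilon>, v + \<epsilon>)\<close> into the first one at \<open>(u, v)\<close>, hence
  \<open>\<beta>\<^sub>\<psi>(u - \<epsilon>, v + \<epsilon>) \<le> \<beta>\<^sub>\<phi>(u, v)\<close>, and over a field this inequality of dimensions gives the
  surjection. The infimum absorbs the difference between strict and weak inequalities, which matters because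
  singular persistent homology need not be right-continuous.

  The analytic input is that \<open>\<beta>\<close> is finite. A finite simplicial complex is a neighbourhood retract in
  Euclidean space; after subdivision, every cycle of a compact set \<open>A\<close> is homologous, inside an open neighbourhood
  of \<open>A\<close>, to a combination of straight simplices with vertices in a fixed finite net of \<open>A\<close>.\<close>

section \<open>Counting points of a persistence diagram\<close>

text \<open>The counts are nested one-dimensional ones. For fixed v, \<beta>(_, v) is a monotone
  integer step function, and its jump at a is antitone in v; the multiplicity of (a, b) is the drop
  of that jump at b, and (a, \<infinity>) takes what never drops. So the same two estimates for sums
  of jumps are applied once in u and once, after the reflection x -> -x, in v. Without one-sided
  continuity the value of \<beta> at a jump is uncontrolled, and only windows around the jump carry
  information. A window must fit into the range considered, and this is why one count is strict and
  the other weak.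

  On the algebraic side, quotients at different levels have different carriers. Each is replaced by
  the image of a linear projection on chains, so that monotonicity and the rectangle inequality
  become statements about dimensions of linear images. Dimensions are cardinalities of bases here,
  hence finiteness has to precede every inequality.\<close>

text \<open>The largest point b of S admits a symmetric window above the other points and below u;
  its increment is disjoint from all that is counted at a separator t. Points of S lie strictly
  below u to leave room for the window.\<close>

lemma sum_jumps_le:
  fixes g :: "real \<Rightarrow> int"
  assumes "finite S"
    and "\<And>x. x \<le> u \<Longrightarrow> 0 \<le> g x"
    and "\<And>x y. x \<le> y \<Longrightarrow> y \<le> u \<Longrightarrow> g x \<le> g y"
    and "\<And>s. s \<in> S \<Longrightarrow> s < u"
    and "\<And>s \<epsilon>. s \<in> S \<Longrightarrow> 0 < \<epsilon> \<Longrightarrow> s + \<epsilon> \<le> u \<Longrightarrow> j s \<le> g (s + \<epsilon>) - g (s - \<epsilon>)"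
  shows "(\<Sum>s\<in>S. j s) \<le> g u"
  using assms
proof (induction S arbitrary: u rule: finite_linorder_max_induct)
  case empty
  then show ?case by simp
next
  case (insert b A)
  have "b < u" using insert.prems by simp
  obtain t where t: "t < b" "\<And>a. a \<in> A \<Longrightarrow> a < t"
  proof (cases "A = {}")
    case True
    then show ?thesis using that[of "b - 1"] by simp
  next
    case False
    then have "Max A < b" using insert.hyps by simp
    then obtain t where "Max A < t" "t < b" using dense by blast
    then show ?thesis using that[of t] insert.hyps(1)
      by (meson Max_ge le_less_trans)
  qed
  have "(\<Sum>s\<in>A. j s) \<le> g t"
  proof (rule insert.IH)
    show "x \<le> t \<Longrightarrow> 0 \<le> g x" for x using insert.prems(1)[of x] t \<open>b < u\<close> by linarith
    show "x \<le> y \<Longrightarrow> y \<le> t \<Longrightarrow> g x \<le> g y" for x y using insert.prems(2)[of x y] t \<open>b < u\<close> by linarith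
    show "s \<in> A \<Longrightarrow> s < t" for s using t by blast
    show "s \<in> A \<Longrightarrow> 0 < \<epsilon> \<Longrightarrow> s + \<epsilon> \<le> t \<Longrightarrow> j s \<le> g (s + \<epsilon>) - g (s - \<epsilon>)" for s \<epsilon>
      using insert.prems(4)[of s \<epsilon>] t \<open>b < u\<close> by simp
  qed
  moreover define \<epsilon> where "\<epsilon> = min (b - t) (u - b)"
  have \<epsilon>: "0 < \<epsilon>" "b + \<epsilon> \<le> u" "t \<le> b - \<epsilon>" using t \<open>b < u\<close> by (auto simp: \<epsilon>_def)
  have "j b \<le> g (b + \<epsilon>) - g (b - \<epsilon>)" using insert.prems(4)[of b \<epsilon>] \<epsilon> by simp
  moreover have "g (b + \<epsilon>) \<le> g u" "g t \<le> g (b - \<epsilon>)"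
    using insert.prems(2)[of "b + \<epsilon>" u] insert.prems(2)[of t "b - \<epsilon>"] \<epsilon> by auto
  moreover have "b \<notin> A" using insert.hyps by blast
  ultimately show ?case using insert.hyps(1) by simp
qed

text \<open>Counts levels instead of points: each integer k in 1..g u is assigned the infimum
  \<open>x k\<close> of the places where g has reached k. The levels assigned to s lie in (g (s -
  \<epsilon>), g (s + \<epsilon>)], so there are at most j s of them. The window may extend beyond
  u, but stays below v.\<close>

lemma le_sum_jumps:
  fixes g :: "real \<Rightarrow> int"
  assumes "u < v"
    and mono: "\<And>x y. x \<le> y \<Longrightarrow> y < v \<Longrightarrow> g x \<le> g y"
    and vanish: "\<And>x. x < l \<Longrightarrow> x < v \<Longrightarrow> g x = 0"
    and jump: "\<And>s. s \<le> u \<Longrightarrow> \<exists>\<epsilon>>0. s + \<epsilon> < v \<and> g (s + \<epsilon>) - g (s - \<epsilon>) \<le> j s"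
  obtains S where "finite S" "S \<subseteq> {..u}" "g u \<le> (\<Sum>s\<in>S. j s)"
proof -
  define x where "x k = Inf {x. x \<le> u \<and> k \<le> g x}" for k
  define S where "S = x ` {1..g u}"
  have bdd: "bdd_below {x. x \<le> u \<and> k \<le> g x}" if "1 \<le> k" for k
  proof (rule bdd_belowI)
    fix y assume "y \<in> {x. x \<le> u \<and> k \<le> g x}"
    then show "l \<le> y" using that vanish[of y] \<open>u < v\<close> by (cases "y < l") auto
  qed
  have le: "x k \<le> u" if "k \<in> {1..g u}" for k
    unfolding x_def using that bdd by (intro cInf_lower) auto
  have card: "int (card {k \<in> {1..g u}. x k = s}) \<le> j s" if "s \<in> S" for s
  proof -
    have "s \<le> u" using that le by (auto simp: S_def)
    then obtain \<epsilon> where \<epsilon>: "0 < \<epsilon>" "s + \<epsilon> < v" "g (s + \<epsilon>) - g (s - \<epsilon>) \<le> j s"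
      using jump by blast
    have "{k \<in> {1..g u}. x k = s} \<subseteq> {g (s - \<epsilon>) <.. g (s + \<epsilon>)}"
    proof clarsimp
      fix k assume k: "1 \<le> k" "k \<le> g u" "s = x k"
      have "\<exists>y\<in>{x. x \<le> u \<and> k \<le> g x}. y < x k + \<epsilon>"
        using k \<epsilon>(1) bdd[OF k(1)] unfolding x_def
        by (subst cInf_less_iff[symmetric]) auto
      then obtain y where "k \<le> g y" "y < s + \<epsilon>" using k(3) by auto
      then have 1: "k \<le> g (x k + \<epsilon>)" using mono[of y "s + \<epsilon>"] \<epsilon> k(3) by simp
      have "\<not> k \<le> g (s - \<epsilon>)"
      proof
        assume "k \<le> g (s - \<epsilon>)"
        then have "x k \<le> s - \<epsilon>" unfolding x_def
          using \<open>s \<le> u\<close> \<epsilon>(1) bdd[OF k(1)] by (intro cInf_lower) auto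
        then show False using k(3) \<epsilon>(1) by simp
      qed
      with 1 k(3) show "g (x k - \<epsilon>) < k \<and> k \<le> g (x k + \<epsilon>)" by simp
    qed
    then have "card {k \<in> {1..g u}. x k = s} \<le> card {g (s - \<epsilon>) <.. g (s + \<epsilon>)}"
      by (intro card_mono) auto
    moreover have "g (s - \<epsilon>) \<le> g (s + \<epsilon>)" using mono[of "s - \<epsilon>" "s + \<epsilon>"] \<epsilon> by simp
    ultimately show ?thesis using \<epsilon>(3) by simp
  qed
  have fin: "finite S" by (simp add: S_def)
  have "g u \<le> int (card {1..g u})" by simp
  also have "card {1..g u} = (\<Sum>s\<in>S. card {k \<in> {1..g u}. x k = s})"
    using sum.image_gen[of "{1..g u}" "\<lambda>_. 1::nat" x] by (simp add: S_def)
  also have "int \<dots> \<le> (\<Sum>s\<in>S. j s)" using card by (auto intro: sum_mono)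
  finally have "g u \<le> (\<Sum>s\<in>S. j s)" .
  moreover have "S \<subseteq> {..u}" using le by (auto simp: S_def)
  ultimately show ?thesis using that fin by blast
qed

text \<open>\<open>LEAST\<close> on int is unspecified for a set without a least element; the lower
  bound 0 reduces it to nat. Multiplicities and jumps are such minima.\<close>

lemma int_Least_nonneg:
  fixes P :: "int \<Rightarrow> bool"
  assumes "P k" and "\<And>m. P m \<Longrightarrow> 0 \<le> m"
  shows "P (LEAST m. P m)" and "\<And>m. P m \<Longrightarrow> (LEAST m. P m) \<le> m"
proof -
  define n where "n = (LEAST n. P (int n))"
  have n: "P (int n)" unfolding n_def using assms by (metis LeastI nonneg_int_cases)
  have le: "int n \<le> m" if "P m" for m
    using that assms(2)[OF that] Least_le[of "\<lambda>n. P (int n)" "nat m"] by (simp add: n_def)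
  have "(LEAST m. P m) = int n" using n le by (intro Least_equality)
  then show "P (LEAST m. P m)" and "\<And>m. P m \<Longrightarrow> (LEAST m. P m) \<le> m"
    using n le by auto
qed

lemma int_less_eq_lessThan: "{i. int i < m} = {..<nat m}"
  by auto

text \<open>In \<open>box_nonneg\<close>, the difference \<beta> u v - \<beta> u v' counts the
  classes present at u that die between v and v'; this number grows with u.\<close>

locale betti_function =
  fixes \<beta> :: "real \<Rightarrow> real \<Rightarrow> nat"
  assumes mono: "u \<le> u' \<Longrightarrow> u' < v' \<Longrightarrow> v' \<le> v \<Longrightarrow> \<beta> u v \<le> \<beta> u' v'"
    and box_nonneg: "u \<le> u' \<Longrightarrow> u' < v \<Longrightarrow> v \<le> v' \<Longrightarrow> \<beta> u v + \<beta> u' v' \<le> \<beta> u' v + \<beta> u v'"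
    and vanish: "\<exists>l. \<forall>u<l. \<forall>v>u. \<beta> u v = 0"
begin

definition diagram :: diagram where
  "diagram = {((u, v), i). ereal u < v \<and> int i < multiplicity_at \<beta> u v} \<union> {((u, v), i). v = ereal u}"

text \<open>The total multiplicity of the points \<open>(a, b)\<close> with \<open>v < b\<close>, for generic \<open>v\<close>.\<close>

definition jump :: "real \<Rightarrow> real \<Rightarrow> int" where
  "jump a v = (LEAST m. \<exists>\<epsilon>>0. a + \<epsilon> < v \<and> m = int (\<beta> (a + \<epsilon>) v) - int (\<beta> (a - \<epsilon>) v))"

section \<open>Jumps in the first coordinate\<close>

lemma jump_attained: "a < v \<Longrightarrow> \<exists>\<epsilon>>0. a + \<epsilon> < v \<and> jump a v = int (\<beta> (a + \<epsilon>) v) - int (\<beta> (a - \<epsilon>) v)"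
  and jump_le: "a < v \<Longrightarrow> 0 < \<epsilon> \<Longrightarrow> a + \<epsilon> < v \<Longrightarrow> jump a v \<le> int (\<beta> (a + \<epsilon>) v) - int (\<beta> (a - \<epsilon>) v)"
proof -
  let ?P = "\<lambda>m. \<exists>\<epsilon>>0. a + \<epsilon> < v \<and> m = int (\<beta> (a + \<epsilon>) v) - int (\<beta> (a - \<epsilon>) v)"
  assume "a < v"
  define \<epsilon> where "\<epsilon> = (v - a) / 2"
  with \<open>a < v\<close> have "0 < \<epsilon>" "a + \<epsilon> < v" by (auto simp: field_simps)
  then have ex: "?P (int (\<beta> (a + \<epsilon>) v) - int (\<beta> (a - \<epsilon>) v))" by blast
  have nn: "0 \<le> m" if "?P m" for m
  proof -
    obtain \<delta> where "0 < \<delta>" "a + \<delta> < v" "m = int (\<beta> (a + \<delta>) v) - int (\<beta> (a - \<delta>) v)"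
      using \<open>?P m\<close> by blast
    then show ?thesis using mono[of "a - \<delta>" "a + \<delta>" v v] by simp
  qed
  show "\<exists>\<epsilon>>0. a + \<epsilon> < v \<and> jump a v = int (\<beta> (a + \<epsilon>) v) - int (\<beta> (a - \<epsilon>) v)"
    unfolding jump_def using int_Least_nonneg(1)[of ?P, OF ex nn] by blast
  show "0 < \<epsilon> \<Longrightarrow> a + \<epsilon> < v \<Longrightarrow> jump a v \<le> int (\<beta> (a + \<epsilon>) v) - int (\<beta> (a - \<epsilon>) v)" for \<epsilon>
    unfolding jump_def using int_Least_nonneg(2)[of ?P, OF ex nn] by blast
qed

text \<open>The increment over a symmetric window shrinks with the window, so a minimum attained at
  one radius is attained at all smaller ones. This permits a common radius for the jumps at several
  levels.\<close>

lemma eventually_jump: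
  assumes "a < v"
  obtains \<epsilon>\<^sub>0 where "0 < \<epsilon>\<^sub>0" "a + \<epsilon>\<^sub>0 < v"
    "\<And>\<epsilon>. 0 < \<epsilon> \<Longrightarrow> \<epsilon> \<le> \<epsilon>\<^sub>0 \<Longrightarrow> jump a v = int (\<beta> (a + \<epsilon>) v) - int (\<beta> (a - \<epsilon>) v)"
proof -
  obtain \<epsilon>\<^sub>0 where \<epsilon>\<^sub>0: "0 < \<epsilon>\<^sub>0" "a + \<epsilon>\<^sub>0 < v" "jump a v = int (\<beta> (a + \<epsilon>\<^sub>0) v) - int (\<beta> (a - \<epsilon>\<^sub>0) v)"
    using jump_attained assms by blast
  have "jump a v = int (\<beta> (a + \<epsilon>) v) - int (\<beta> (a - \<epsilon>) v)" if "0 < \<epsilon>" "\<epsilon> \<le> \<epsilon>\<^sub>0" for \<epsilon>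
    using jump_le[of a v \<epsilon>] assms that \<epsilon>\<^sub>0 mono[of "a + \<epsilon>" "a + \<epsilon>\<^sub>0" v v] mono[of "a - \<epsilon>\<^sub>0" "a - \<epsilon>" v v]
    by simp
  with \<epsilon>\<^sub>0 that show ?thesis by blast
qed

lemma jump_nonneg:
  assumes "a < v" shows "0 \<le> jump a v"
proof -
  obtain \<epsilon> where "0 < \<epsilon>" "a + \<epsilon> < v" "jump a v = int (\<beta> (a + \<epsilon>) v) - int (\<beta> (a - \<epsilon>) v)"
    using jump_attained assms by blast
  then show ?thesis using mono[of "a - \<epsilon>" "a + \<epsilon>" v v] by simp
qed

text \<open>Rectangle nonnegativity over the window times [v, v']: a class born at a that outlives
  v' also outlives v.\<close>

lemma jump_antimono:
  assumes "a < v" "v \<le> v'" shows "jump a v' \<le> jump a v"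
proof -
  obtain \<epsilon> where \<epsilon>: "0 < \<epsilon>" "a + \<epsilon> < v" "jump a v = int (\<beta> (a + \<epsilon>) v) - int (\<beta> (a - \<epsilon>) v)"
    using jump_attained assms by blast
  then show ?thesis using jump_le[of a v' \<epsilon>] box_nonneg[of "a - \<epsilon>" "a + \<epsilon>" v v'] assms by simp
qed

lemma sum_jump_le:
  assumes "finite S" "S \<subseteq> {..<u}" "u < v"
  shows "(\<Sum>a\<in>S. jump a v) \<le> int (\<beta> u v)"
proof (rule sum_jumps_le[where g = "\<lambda>x. int (\<beta> x v)"])
  show "s \<in> S \<Longrightarrow> 0 < \<epsilon> \<Longrightarrow> s + \<epsilon> \<le> u \<Longrightarrow> jump s v \<le> int (\<beta> (s + \<epsilon>) v) - int (\<beta> (s - \<epsilon>) v)" for s \<epsilon>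
    using assms jump_le[of s v \<epsilon>] by auto
qed (use assms mono in auto)

lemma le_sum_jump:
  assumes "u < v"
  obtains S where "finite S" "S \<subseteq> {..u}" "int (\<beta> u v) \<le> (\<Sum>a\<in>S. jump a v)"
proof -
  obtain l where l: "\<And>u v. u < l \<Longrightarrow> u < v \<Longrightarrow> \<beta> u v = 0" using vanish by blast
  show ?thesis
  proof (rule le_sum_jumps[of u v "\<lambda>x. int (\<beta> x v)" l "\<lambda>a. jump a v"])
    show "s \<le> u \<Longrightarrow> \<exists>\<epsilon>>0. s + \<epsilon> < v \<and> int (\<beta> (s + \<epsilon>) v) - int (\<beta> (s - \<epsilon>) v) \<le> jump s v" for s
      using jump_attained[of s v] assms by fastforce
  qed (use assms mono l that in auto)
qed

section \<open>Multiplicities as drops of the jump\<close>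

lemma multiplicity_finite:
  assumes "a < b"
  shows "\<exists>\<epsilon>>0. a + \<epsilon> < b - \<epsilon> \<and> multiplicity_at \<beta> a (ereal b) =
      int (\<beta> (a + \<epsilon>) (b - \<epsilon>)) - int (\<beta> (a - \<epsilon>) (b - \<epsilon>)) - int (\<beta> (a + \<epsilon>) (b + \<epsilon>)) + int (\<beta> (a - \<epsilon>) (b + \<epsilon>))"
    and "\<And>\<epsilon>. 0 < \<epsilon> \<Longrightarrow> a + \<epsilon> < b - \<epsilon> \<Longrightarrow> multiplicity_at \<beta> a (ereal b) \<le>
      int (\<beta> (a + \<epsilon>) (b - \<epsilon>)) - int (\<beta> (a - \<epsilon>) (b - \<epsilon>)) - int (\<beta> (a + \<epsilon>) (b + \<epsilon>)) + int (\<beta> (a - \<epsilon>) (b + \<epsilon>))"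
proof -
  let ?f = "\<lambda>\<epsilon>. int (\<beta> (a + \<epsilon>) (b - \<epsilon>)) - int (\<beta> (a - \<epsilon>) (b - \<epsilon>)) - int (\<beta> (a + \<epsilon>) (b + \<epsilon>)) + int (\<beta> (a - \<epsilon>) (b + \<epsilon>))"
  let ?P = "\<lambda>m. \<exists>\<epsilon>>0. a + \<epsilon> < b - \<epsilon> \<and> m = ?f \<epsilon>"
  have ex: "?P (?f ((b - a) / 4))" using assms by (intro exI[of _ "(b - a) / 4"]) (simp add: field_simps)
  have nn: "0 \<le> m" if P: "?P m" for m
  proof -
    obtain \<epsilon> where "0 < \<epsilon>" "a + \<epsilon> < b - \<epsilon>" "m = ?f \<epsilon>" using P by blast
    then show ?thesis using box_nonneg[of "a - \<epsilon>" "a + \<epsilon>" "b - \<epsilon>" "b + \<epsilon>"] by simp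
  qed
  have eq: "multiplicity_at \<beta> a (ereal b) = (LEAST m. ?P m)" by (simp add: multiplicity_at_def)
  show "\<exists>\<epsilon>>0. a + \<epsilon> < b - \<epsilon> \<and> multiplicity_at \<beta> a (ereal b) = ?f \<epsilon>"
    unfolding eq using int_Least_nonneg(1)[of ?P, OF ex nn] by blast
  show "\<And>\<epsilon>. 0 < \<epsilon> \<Longrightarrow> a + \<epsilon> < b - \<epsilon> \<Longrightarrow> multiplicity_at \<beta> a (ereal b) \<le> ?f \<epsilon>"
    unfolding eq using int_Least_nonneg(2)[of ?P, OF ex nn] by blast
qed

lemma multiplicity_infinite:
  shows "\<exists>\<epsilon>>0. a + \<epsilon> < 1 / \<epsilon> \<and> multiplicity_at \<beta> a \<infinity> = int (\<beta> (a + \<epsilon>) (1 / \<epsilon>)) - int (\<beta> (a - \<epsilon>) (1 / \<epsilon>))"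
    and "\<And>\<epsilon>. 0 < \<epsilon> \<Longrightarrow> a + \<epsilon> < 1 / \<epsilon> \<Longrightarrow>
      multiplicity_at \<beta> a \<infinity> \<le> int (\<beta> (a + \<epsilon>) (1 / \<epsilon>)) - int (\<beta> (a - \<epsilon>) (1 / \<epsilon>))"
proof -
  let ?f = "\<lambda>\<epsilon>. int (\<beta> (a + \<epsilon>) (1 / \<epsilon>)) - int (\<beta> (a - \<epsilon>) (1 / \<epsilon>))"
  let ?P = "\<lambda>m. \<exists>\<epsilon>>0. a + \<epsilon> < 1 / \<epsilon> \<and> m = ?f \<epsilon>"
  \<comment> \<open>With this radius, a + \<epsilon> \<le> a + 1 < |a| + 2 = 1 / \<epsilon>.\<close>
  define \<epsilon> where "\<epsilon> = 1 / (\<bar>a\<bar> + 2)"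
  have "0 < \<epsilon>" "\<epsilon> \<le> 1" "1 / \<epsilon> = \<bar>a\<bar> + 2" by (auto simp: \<epsilon>_def)
  then have ex: "?P (?f \<epsilon>)" by (intro exI[of _ \<epsilon>]) auto
  have nn: "0 \<le> m" if P: "?P m" for m
  proof -
    obtain \<epsilon> where "0 < \<epsilon>" "a + \<epsilon> < 1 / \<epsilon>" "m = ?f \<epsilon>" using P by blast
    then show ?thesis using mono[of "a - \<epsilon>" "a + \<epsilon>" "1 / \<epsilon>" "1 / \<epsilon>"] by simp
  qed
  have eq: "multiplicity_at \<beta> a \<infinity> = (LEAST m. ?P m)" by (simp add: multiplicity_at_def)
  show "\<exists>\<epsilon>>0. a + \<epsilon> < 1 / \<epsilon> \<and> multiplicity_at \<beta> a \<infinity> = ?f \<epsilon>"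
    unfolding eq using int_Least_nonneg(1)[of ?P, OF ex nn] by blast
  show "\<And>\<epsilon>. 0 < \<epsilon> \<Longrightarrow> a + \<epsilon> < 1 / \<epsilon> \<Longrightarrow> multiplicity_at \<beta> a \<infinity> \<le> ?f \<epsilon>"
    unfolding eq using int_Least_nonneg(2)[of ?P, OF ex nn] by blast
qed

text \<open>A radius \<delta> that realizes the jumps at both levels b - \<epsilon> and b +
  \<epsilon> gives a \<delta>-square inside the rectangle of half-width \<delta> and half-height
  \<epsilon>; the strips left over below and above the square are nonnegative.\<close>

lemma multiplicity_le_jump_diff:
  assumes "0 < \<epsilon>" "a < b - \<epsilon>"
  shows "multiplicity_at \<beta> a (ereal b) \<le> jump a (b - \<epsilon>) - jump a (b + \<epsilon>)"
proof -
  obtain \<epsilon>1 where 1: "0 < \<epsilon>1" "a + \<epsilon>1 < b - \<epsilon>"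
    "\<And>\<delta>. 0 < \<delta> \<Longrightarrow> \<delta> \<le> \<epsilon>1 \<Longrightarrow> jump a (b - \<epsilon>) = int (\<beta> (a + \<delta>) (b - \<epsilon>)) - int (\<beta> (a - \<delta>) (b - \<epsilon>))"
    using eventually_jump assms by blast
  obtain \<epsilon>2 where 2: "0 < \<epsilon>2" "a + \<epsilon>2 < b + \<epsilon>"
    "\<And>\<delta>. 0 < \<delta> \<Longrightarrow> \<delta> \<le> \<epsilon>2 \<Longrightarrow> jump a (b + \<epsilon>) = int (\<beta> (a + \<delta>) (b + \<epsilon>)) - int (\<beta> (a - \<delta>) (b + \<epsilon>))"
    using eventually_jump[of a "b + \<epsilon>"] assms by auto
  define \<delta> where "\<delta> = min \<epsilon> (min \<epsilon>1 \<epsilon>2)"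
  have \<delta>: "0 < \<delta>" "\<delta> \<le> \<epsilon>" "\<delta> \<le> \<epsilon>1" "\<delta> \<le> \<epsilon>2" using assms 1 2 by (auto simp: \<delta>_def)
  show ?thesis
    using multiplicity_finite(2)[of a b \<delta>] 1(3)[of \<delta>] 2(3)[of \<delta>] \<delta> assms 1(2)
      box_nonneg[of "a - \<delta>" "a + \<delta>" "b - \<epsilon>" "b - \<delta>"] box_nonneg[of "a - \<delta>" "a + \<delta>" "b + \<delta>" "b + \<epsilon>"]
    by simp
qed

text \<open>The opposite comparison starts from a square that attains the multiplicity: a narrower
  rectangle of the same height realizes the jumps, and the strips to its left and right are
  nonnegative.\<close>

lemma jump_diff_le_multiplicity:
  assumes "a < b"
  shows "\<exists>\<epsilon>>0. a < b - \<epsilon> \<and> jump a (b - \<epsilon>) - jump a (b + \<epsilon>) \<le> multiplicity_at \<beta> a (ereal b)"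
proof -
  obtain \<epsilon> where \<epsilon>: "0 < \<epsilon>" "a + \<epsilon> < b - \<epsilon>" "multiplicity_at \<beta> a (ereal b) =
      int (\<beta> (a + \<epsilon>) (b - \<epsilon>)) - int (\<beta> (a - \<epsilon>) (b - \<epsilon>)) - int (\<beta> (a + \<epsilon>) (b + \<epsilon>)) + int (\<beta> (a - \<epsilon>) (b + \<epsilon>))"
    using multiplicity_finite(1)[OF assms] by blast
  obtain \<epsilon>1 where 1: "0 < \<epsilon>1" "a + \<epsilon>1 < b - \<epsilon>"
    "\<And>\<delta>. 0 < \<delta> \<Longrightarrow> \<delta> \<le> \<epsilon>1 \<Longrightarrow> jump a (b - \<epsilon>) = int (\<beta> (a + \<delta>) (b - \<epsilon>)) - int (\<beta> (a - \<delta>) (b - \<epsilon>))"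
    using eventually_jump[of a "b - \<epsilon>"] \<epsilon> by auto
  obtain \<epsilon>2 where 2: "0 < \<epsilon>2" "a + \<epsilon>2 < b + \<epsilon>"
    "\<And>\<delta>. 0 < \<delta> \<Longrightarrow> \<delta> \<le> \<epsilon>2 \<Longrightarrow> jump a (b + \<epsilon>) = int (\<beta> (a + \<delta>) (b + \<epsilon>)) - int (\<beta> (a - \<delta>) (b + \<epsilon>))"
    using eventually_jump[of a "b + \<epsilon>"] \<epsilon> by auto
  define \<delta> where "\<delta> = min \<epsilon> (min \<epsilon>1 \<epsilon>2)"
  have \<delta>: "0 < \<delta>" "\<delta> \<le> \<epsilon>" "\<delta> \<le> \<epsilon>1" "\<delta> \<le> \<epsilon>2" using \<epsilon> 1 2 by (auto simp: \<delta>_def)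
  show ?thesis
    using \<epsilon> 1(3)[of \<delta>] 2(3)[of \<delta>] \<delta>
      box_nonneg[of "a - \<epsilon>" "a - \<delta>" "b - \<epsilon>" "b + \<epsilon>"] box_nonneg[of "a + \<delta>" "a + \<epsilon>" "b - \<epsilon>" "b + \<epsilon>"]
    by (intro exI[of _ \<epsilon>]) simp
qed

lemma multiplicity_infinite_le_jump:
  assumes "a < v"
  shows "multiplicity_at \<beta> a \<infinity> \<le> jump a v"
proof -
  obtain \<epsilon>1 where 1: "0 < \<epsilon>1" "a + \<epsilon>1 < v"
    "\<And>\<delta>. 0 < \<delta> \<Longrightarrow> \<delta> \<le> \<epsilon>1 \<Longrightarrow> jump a v = int (\<beta> (a + \<delta>) v) - int (\<beta> (a - \<delta>) v)"
    using eventually_jump assms by blast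
  \<comment> \<open>The bound 1 / (|v| + 1) puts the level 1 / \<delta> above v.\<close>
  define \<delta> where "\<delta> = min \<epsilon>1 (1 / (\<bar>v\<bar> + 1))"
  have \<delta>: "0 < \<delta>" "\<delta> \<le> \<epsilon>1" "\<delta> \<le> 1 / (\<bar>v\<bar> + 1)" using 1(1) by (auto simp: \<delta>_def)
  have "v \<le> 1 / \<delta>" using \<delta> by (simp add: field_simps) (smt (verit) mult_left_mono)
  then show ?thesis
    using 1 multiplicity_infinite(2)[of \<delta> a] \<delta> box_nonneg[of "a - \<delta>" "a + \<delta>" v "1 / \<delta>"] by simp
qed

text \<open>The level is 1 / \<epsilon> for a radius attaining the multiplicity. With
  \<open>multiplicity_infinite_le_jump\<close> and antitonicity, the jump at a is constant from this
  level on.\<close>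

lemma jump_le_multiplicity_infinite: "\<exists>v>a. jump a v \<le> multiplicity_at \<beta> a \<infinity>"
proof -
  obtain \<epsilon> where "0 < \<epsilon>" "a + \<epsilon> < 1 / \<epsilon>" "multiplicity_at \<beta> a \<infinity> = int (\<beta> (a + \<epsilon>) (1 / \<epsilon>)) - int (\<beta> (a - \<epsilon>) (1 / \<epsilon>))"
    using multiplicity_infinite(1) by blast
  then show ?thesis using jump_le[of a "1 / \<epsilon>" \<epsilon>] by (intro exI[of _ "1 / \<epsilon>"]) simp
qed

lemma multiplicity_nonneg: "ereal a < b \<Longrightarrow> 0 \<le> multiplicity_at \<beta> a b"
proof (cases b)
  case (real r)
  assume "ereal a < b"
  then obtain \<epsilon> where "0 < \<epsilon>" "a < r - \<epsilon>" "jump a (r - \<epsilon>) - jump a (r + \<epsilon>) \<le> multiplicity_at \<beta> a b"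
    using jump_diff_le_multiplicity[of a r] real by auto
  then show ?thesis using jump_antimono[of a "r - \<epsilon>" "r + \<epsilon>"] by simp
next
  case PInf
  then show ?thesis using jump_le_multiplicity_infinite[of a] jump_nonneg by force
qed auto

text \<open>Reflection makes the antitone jump monotone, and subtracting the multiplicity of (a,
  \<infinity>) keeps it nonnegative, so \<open>sum_jumps_le\<close> bounds the finite part of Q. The
  subtracted term pays for the point at infinity.\<close>

lemma sum_multiplicity_le:
  assumes "finite Q" "\<And>b. b \<in> Q \<Longrightarrow> ereal v < b" "a < v"
  shows "(\<Sum>b\<in>Q. multiplicity_at \<beta> a b) \<le> jump a v"
proof -
  define R where "R = {r. ereal (- r) \<in> Q}"
  have fin: "finite R"
  proof -
    have "(\<lambda>r. ereal (- r)) ` R \<subseteq> Q" by (auto simp: R_def)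
    then show ?thesis using assms(1) by (meson finite_imageD finite_subset inj_onI ereal.inject neg_equal_iff_equal)
  qed
  have "(\<Sum>r\<in>R. multiplicity_at \<beta> a (ereal (- r))) \<le> jump a (- (- v)) - multiplicity_at \<beta> a \<infinity>"
  proof (rule sum_jumps_le[where g = "\<lambda>x. jump a (- x) - multiplicity_at \<beta> a \<infinity>"])
    show "x \<le> - v \<Longrightarrow> 0 \<le> jump a (- x) - multiplicity_at \<beta> a \<infinity>" for x
      using multiplicity_infinite_le_jump[of a "- x"] assms by simp
    show "x \<le> y \<Longrightarrow> y \<le> - v \<Longrightarrow> jump a (- x) - multiplicity_at \<beta> a \<infinity> \<le> jump a (- y) - multiplicity_at \<beta> a \<infinity>" for x y
      using jump_antimono[of a "- y" "- x"] assms by simp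
    show "s \<in> R \<Longrightarrow> s < - v" for s using assms(2)[of "ereal (- s)"] by (simp add: R_def)
    show "s \<in> R \<Longrightarrow> 0 < \<epsilon> \<Longrightarrow> s + \<epsilon> \<le> - v \<Longrightarrow>
       multiplicity_at \<beta> a (ereal (- s))
         \<le> jump a (- (s + \<epsilon>)) - multiplicity_at \<beta> a \<infinity> - (jump a (- (s - \<epsilon>)) - multiplicity_at \<beta> a \<infinity>)" for s \<epsilon>
    proof -
      assume "0 < \<epsilon>" "s + \<epsilon> \<le> - v"
      moreover have "- (s + \<epsilon>) = - s - \<epsilon>" "- (s - \<epsilon>) = - s + \<epsilon>" by simp_all
      ultimately show ?thesis using multiplicity_le_jump_diff[of \<epsilon> a "- s"] assms(3) by simp
    qed
  qed fact
  also have "(\<Sum>r\<in>R. multiplicity_at \<beta> a (ereal (- r))) = (\<Sum>b\<in>Q - {\<infinity>}. multiplicity_at \<beta> a b)"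
  proof (rule sum.reindex_cong[symmetric, where l = "\<lambda>r. ereal (- r)"])
    show "Q - {\<infinity>} = (\<lambda>r. ereal (- r)) ` R"
    proof -
      have "b \<in> (\<lambda>r. ereal (- r)) ` R" if "b \<in> Q" "b \<noteq> \<infinity>" for b
      proof (cases b)
        case (real r)
        then have "- r \<in> R" "b = ereal (- (- r))" using that by (simp_all add: R_def)
        then show ?thesis by (rule rev_image_eqI)
      qed (use that assms(2)[of b] in auto)
      then show ?thesis by (auto simp: R_def)
    qed
  qed (auto simp: inj_on_def)
  finally have "(\<Sum>b\<in>Q - {\<infinity>}. multiplicity_at \<beta> a b) + multiplicity_at \<beta> a \<infinity> \<le> jump a v" by simp
  moreover have "0 \<le> multiplicity_at \<beta> a \<infinity>" by (simp add: multiplicity_nonneg)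
  ultimately show ?thesis
    using assms(1) by (cases "\<infinity> \<in> Q") (auto simp: sum.remove)
qed

text \<open>The reflected jump minus the multiplicity of (a, \<infinity>) vanishes below -w, where
  the jump has become constant; this is the vanishing that \<open>le_sum_jumps\<close> asks
  for.\<close>

lemma le_sum_multiplicity:
  assumes "a < v"
  obtains Q where "finite Q" "\<And>b. b \<in> Q \<Longrightarrow> ereal v \<le> b" "jump a v \<le> (\<Sum>b\<in>Q. multiplicity_at \<beta> a b)"
proof -
  obtain w where w: "a < w" "jump a w \<le> multiplicity_at \<beta> a \<infinity>" using jump_le_multiplicity_infinite by blast
  have w': "jump a x = multiplicity_at \<beta> a \<infinity>" if "w \<le> x" for x
    using that w jump_antimono[of a w x] multiplicity_infinite_le_jump[of a x] by simp
  obtain R where R: "finite R" "R \<subseteq> {..- v}"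
     "jump a (- (- v)) - multiplicity_at \<beta> a \<infinity> \<le> (\<Sum>r\<in>R. multiplicity_at \<beta> a (ereal (- r)))"
  proof (rule le_sum_jumps[of "- v" "- a" "\<lambda>x. jump a (- x) - multiplicity_at \<beta> a \<infinity>" "- w" "\<lambda>r. multiplicity_at \<beta> a (ereal (- r))"])
    show "x \<le> y \<Longrightarrow> y < - a \<Longrightarrow> jump a (- x) - multiplicity_at \<beta> a \<infinity> \<le> jump a (- y) - multiplicity_at \<beta> a \<infinity>" for x y
      using jump_antimono[of a "- y" "- x"] by simp
    show "x < - w \<Longrightarrow> x < - a \<Longrightarrow> jump a (- x) - multiplicity_at \<beta> a \<infinity> = 0" for x
      using w'[of "- x"] by simp
    show "\<exists>\<epsilon>>0. s + \<epsilon> < - a \<and>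
           jump a (- (s + \<epsilon>)) - multiplicity_at \<beta> a \<infinity> - (jump a (- (s - \<epsilon>)) - multiplicity_at \<beta> a \<infinity>)
             \<le> multiplicity_at \<beta> a (ereal (- s))" if "s \<le> - v" for s
    proof -
      obtain \<epsilon> where "0 < \<epsilon>" "a < - s - \<epsilon>" "jump a (- s - \<epsilon>) - jump a (- s + \<epsilon>) \<le> multiplicity_at \<beta> a (ereal (- s))"
        using jump_diff_le_multiplicity[of a "- s"] \<open>s \<le> - v\<close> assms by auto
      moreover have "- (s + \<epsilon>) = - s - \<epsilon>" "- (s - \<epsilon>) = - s + \<epsilon>" by simp_all
      ultimately show ?thesis by (intro exI[of _ \<epsilon>]) simp
    qed
  qed (use assms in auto)
  \<comment> \<open>The point at infinity restores the subtracted constant.\<close>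
  define Q where "Q = insert \<infinity> ((\<lambda>r. ereal (- r)) ` R)"
  have "inj_on (\<lambda>r. ereal (- r)) R" by (auto simp: inj_on_def)
  then have "(\<Sum>b\<in>Q. multiplicity_at \<beta> a b) = multiplicity_at \<beta> a \<infinity> + (\<Sum>r\<in>R. multiplicity_at \<beta> a (ereal (- r)))"
    unfolding Q_def using R(1) by (subst sum.insert) (auto simp: sum.reindex)
  then show ?thesis using that[of Q] R by (fastforce simp: Q_def)
qed

section \<open>Counting the points in a quadrant\<close>

text \<open>As a < u < v < b, T misses the diagonal, so each of its points occurs with at most
  \<open>multiplicity_at\<close> copies. These are summed over b for fixed a, then over a.\<close>

lemma card_quadrant_le:
  assumes "finite T" "T \<subseteq> diagram" "u < v"
    and T: "\<And>a b i. ((a, b), i) \<in> T \<Longrightarrow> a < u \<and> ereal v < b"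
  shows "card T \<le> \<beta> u v"
proof -
  let ?m = "\<lambda>p. multiplicity_at \<beta> (fst p) (snd p)"
  let ?P = "fst ` T"
  let ?A = "fst ` ?P"
  let ?Q = "\<lambda>a. {b. (a, b) \<in> ?P}"
  have P: "ereal a < b" if ab: "(a, b) \<in> ?P" for a b
  proof -
    obtain i where "((a, b), i) \<in> T" using ab by auto
    then have "a < v" "ereal v < b" using T[of a b i] \<open>u < v\<close> by auto
    then show ?thesis by (meson less_ereal.simps(1) less_trans)
  qed
  have finQ: "finite (?Q a)" for a
  proof (rule finite_subset)
    show "?Q a \<subseteq> snd ` ?P" by (auto intro: rev_image_eqI)
    show "finite (snd ` ?P)" using assms(1) by simp
  qed
  have "T \<subseteq> (SIGMA p:?P. {i. int i < ?m p})"
  proof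
    fix p assume "p \<in> T"
    obtain a b i where p: "p = ((a, b), i)" by (metis prod.exhaust)
    then have ab: "(a, b) \<in> ?P" using \<open>p \<in> T\<close> by (metis fst_conv imageI)
    then have "ereal a < b" using P by blast
    then have "int i < multiplicity_at \<beta> a b" using \<open>p \<in> T\<close> assms(2) p by (auto simp: diagram_def)
    then show "p \<in> (SIGMA p:?P. {i. int i < ?m p})" using ab p by simp
  qed
  then have "card T \<le> card (SIGMA p:?P. {i. int i < ?m p})"
    using assms(1) by (intro card_mono finite_SigmaI) (auto simp: int_less_eq_lessThan)
  also have "\<dots> = (\<Sum>p\<in>?P. nat (?m p))" using assms(1) by (simp add: card_SigmaI int_less_eq_lessThan)
  finally have "int (card T) \<le> int (\<Sum>p\<in>?P. nat (?m p))" by (rule zle_int[THEN iffD2])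
  also have "\<dots> = (\<Sum>p\<in>?P. ?m p)"
    using P multiplicity_nonneg by (auto intro!: sum.cong)
  also have "\<dots> = (\<Sum>p\<in>(SIGMA a:?A. ?Q a). ?m p)"
  proof (rule sum.cong)
    show "?P = (SIGMA a:?A. ?Q a)" by (auto intro: rev_image_eqI)
  qed simp
  also have "\<dots> = (\<Sum>a\<in>?A. \<Sum>b\<in>?Q a. multiplicity_at \<beta> a b)"
    using assms(1) finQ by (subst sum.Sigma) (auto simp: case_prod_unfold)
  also have "\<dots> \<le> (\<Sum>a\<in>?A. jump a v)"
  proof (intro sum_mono sum_multiplicity_le)
    fix a assume "a \<in> ?A"
    then have "a < u" using T by auto
    then show "a < v" using \<open>u < v\<close> by simp
  qed (use T finQ in auto)
  also have "\<dots> \<le> int (\<beta> u v)"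
    using assms(1,3) T by (intro sum_jump_le) auto
  finally show ?thesis by simp
qed

text \<open>T consists of all copies of the points listed by the two lower estimates: S gives the
  first coordinates, \<open>Q a\<close> the second ones. Listed points of multiplicity zero
  contribute no copies.\<close>

lemma le_card_quadrant:
  assumes "u < v"
  obtains T where "finite T" "T \<subseteq> diagram" "\<And>a b i. ((a, b), i) \<in> T \<Longrightarrow> a \<le> u \<and> ereal v \<le> b"
    "\<beta> u v \<le> card T"
proof -
  obtain S where S: "finite S" "S \<subseteq> {..u}" "int (\<beta> u v) \<le> (\<Sum>a\<in>S. jump a v)"
    using le_sum_jump[OF assms] by blast
  have "\<exists>Q. finite Q \<and> (\<forall>b\<in>Q. ereal v \<le> b) \<and> jump a v \<le> (\<Sum>b\<in>Q. multiplicity_at \<beta> a b)" if "a \<in> S" for a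
    using le_sum_multiplicity[of a v] that S(2) assms by (metis atMost_iff le_less_trans subsetD)
  then obtain Q where Q: "\<And>a. a \<in> S \<Longrightarrow> finite (Q a)" "\<And>a b. a \<in> S \<Longrightarrow> b \<in> Q a \<Longrightarrow> ereal v \<le> b"
     "\<And>a. a \<in> S \<Longrightarrow> jump a v \<le> (\<Sum>b\<in>Q a. multiplicity_at \<beta> a b)" by metis
  let ?m = "\<lambda>p. multiplicity_at \<beta> (fst p) (snd p)"
  define P where "P = (SIGMA a:S. Q a)"
  define T where "T = (SIGMA p:P. {i. int i < ?m p})"
  have finP: "finite P" unfolding P_def using S(1) Q(1) by (rule finite_SigmaI)
  have P: "a \<le> u" "ereal v \<le> b" "ereal a < b" if "(a, b) \<in> P" for a b
  proof -
    show "a \<le> u" "ereal v \<le> b" using that S(2) Q(2) by (auto simp: P_def)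
    then show "ereal a < b" using assms by (metis ereal_less_eq(3) less_ereal.simps(1) less_le_trans order_le_less_trans)
  qed
  have "int (\<beta> u v) \<le> (\<Sum>a\<in>S. \<Sum>b\<in>Q a. multiplicity_at \<beta> a b)"
    using S(3) Q(3) sum_mono[of S "\<lambda>a. jump a v" "\<lambda>a. \<Sum>b\<in>Q a. multiplicity_at \<beta> a b"] by simp
  also have "\<dots> = (\<Sum>p\<in>P. ?m p)"
    unfolding P_def using S(1) Q(1) by (subst sum.Sigma) (auto simp: case_prod_unfold)
  also have "\<dots> = int (\<Sum>p\<in>P. nat (?m p))"
    using P multiplicity_nonneg by (auto intro!: sum.cong)
  also have "(\<Sum>p\<in>P. nat (?m p)) = card T"
    unfolding T_def using finP by (simp add: card_SigmaI int_less_eq_lessThan)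
  finally have "\<beta> u v \<le> card T" by simp
  moreover have "finite T" unfolding T_def using finP by (simp add: int_less_eq_lessThan)
  moreover have "T \<subseteq> diagram" using P by (auto simp: T_def diagram_def)
  moreover have "\<And>a b i. ((a, b), i) \<in> T \<Longrightarrow> a \<le> u \<and> ereal v \<le> b" using P by (auto simp: T_def)
  ultimately show ?thesis using that by blast
qed

end

lemma betti_le_of_diagram_injection:
  assumes "betti_function \<beta>" "betti_function \<gamma>" "u < v" "0 \<le> \<epsilon>"
    and "inj_on g (betti_function.diagram \<gamma>)"
    and "g ` betti_function.diagram \<gamma> \<subseteq> betti_function.diagram \<beta>"
    and close: "\<And>p. p \<in> betti_function.diagram \<gamma> \<Longrightarrow> displacement (fst p) (fst (g p)) < ereal \<epsilon>"
  shows "\<gamma> (u - \<epsilon>) (v + \<epsilon>) \<le> \<beta> u v"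
proof -
  interpret \<beta>: betti_function \<beta> by fact
  interpret \<gamma>: betti_function \<gamma> by fact
  obtain T where T: "finite T" "T \<subseteq> \<gamma>.diagram" "\<gamma> (u - \<epsilon>) (v + \<epsilon>) \<le> card T"
    "\<And>a b i. ((a, b), i) \<in> T \<Longrightarrow> a \<le> u - \<epsilon> \<and> ereal (v + \<epsilon>) \<le> b"
    by (rule \<gamma>.le_card_quadrant[of "u - \<epsilon>" "v + \<epsilon>"]) (use \<open>u < v\<close> \<open>0 \<le> \<epsilon>\<close> in auto)
  have "card T = card (g ` T)" using assms(5) T(2) by (metis card_image inj_on_subset)
  also have "\<dots> \<le> \<beta> u v"
  proof (rule \<beta>.card_quadrant_le)
    show "finite (g ` T)" "g ` T \<subseteq> \<beta>.diagram" using T(1,2) assms(6) by blast+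
    fix a' b' i' assume "((a', b'), i') \<in> g ` T"
    then obtain a b i where ab: "((a, b), i) \<in> T" "g ((a, b), i) = ((a', b'), i')" by auto
    then have "displacement (a, b) (a', b') < ereal \<epsilon>" using close T(2) by (metis fst_conv subsetD)
    then have "\<bar>a - a'\<bar> < \<epsilon>" "(if b = b' then 0 else \<bar>b - b'\<bar>) < ereal \<epsilon>"
      by (auto simp: displacement_def)
    moreover have "a \<le> u - \<epsilon>" "ereal (v + \<epsilon>) \<le> b" using T(4) ab by blast+
    \<comment> \<open>A displacement below \<epsilon> forces b and b' to be infinite together, and
      its strictness turns the weak bounds on (a, b) into strict ones.\<close>
    ultimately show "a' < u \<and> ereal v < b'"
      by (cases b; cases b') (auto split: if_splits)
  qed fact
  finally show ?thesis using T(3) by simp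
qed

section \<open>Vector spaces\<close>

text \<open>Homology is a module record with a carrier, while the linear algebra is done in
  subspaces of a \<open>vector_space\<close>. Here h is a linear isomorphism from U onto the record
  V.\<close>

definition models :: "('a \<Rightarrow> 'b \<Rightarrow> 'b) \<Rightarrow> 'b::ab_group_add set \<Rightarrow> ('b \<Rightarrow> 'c) \<Rightarrow> ('a, 'c) module \<Rightarrow> bool" where
  "models s U h V \<longleftrightarrow> bij_betw h U (carrier V) \<and> h 0 = \<zero>\<^bsub>V\<^esub> \<and>
     (\<forall>x\<in>U. \<forall>y\<in>U. h (x + y) = h x \<oplus>\<^bsub>V\<^esub> h y) \<and> (\<forall>a. \<forall>x\<in>U. h (s a x) = a \<odot>\<^bsub>V\<^esub> h x)"

context vector_space
begin

text \<open>A basis of B is extended to a basis of the whole space; q kills the former and fixes the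
  added vectors. Its image stands in for the quotient by B.\<close>

lemma linear_projection_exists:
  assumes "subspace B"
  obtains q where "Vector_Spaces.linear scale scale q" "\<And>x. q x = 0 \<longleftrightarrow> x \<in> B" "\<And>x. x - q x \<in> B"
proof -
  interpret vector_space_pair scale scale ..
  obtain B0 where B0: "B0 \<subseteq> B" "independent B0" "B \<subseteq> span B0"
    by (rule maximal_independent_subset)
  obtain C where C: "B0 \<subseteq> C" "independent C" "UNIV \<subseteq> span C"
    by (rule maximal_independent_subset_extend[OF subset_UNIV B0(2)])
  define q where "q = construct C (\<lambda>c. if c \<in> B0 then 0 else c)"
  have lin: "Vector_Spaces.linear scale scale q" unfolding q_def by (rule linear_construct) fact
  interpret q: Vector_Spaces.linear scale scale q by fact
  have q: "q c = (if c \<in> B0 then 0 else c)" if "c \<in> C" for c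
    unfolding q_def using C(2) that by (rule construct_basis)
  have "subspace {x. x - q x \<in> B}"
  proof (rule subspaceI)
    show "x + y \<in> {x. x - q x \<in> B}" if "x \<in> {x. x - q x \<in> B}" "y \<in> {x. x - q x \<in> B}" for x y
      using subspace_add[OF assms, of "x - q x" "y - q y"] that by (simp add: q.add algebra_simps)
    show "scale c x \<in> {x. x - q x \<in> B}" if "x \<in> {x. x - q x \<in> B}" for c x
      using subspace_scale[OF assms, of "x - q x" c] that by (simp add: q.scale scale_right_diff_distrib)
  qed (simp add: subspace_0[OF assms] q.zero)
  moreover have "C \<subseteq> {x. x - q x \<in> B}" using q B0(1) subspace_0[OF assms] by auto
  ultimately have diff: "x - q x \<in> B" for x
    using C(3) span_minimal by blast
  have "subspace {x. q x = 0}" by (rule q.subspace_kernel)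
  moreover have "B0 \<subseteq> {x. q x = 0}" using q C(1) by auto
  ultimately have "q x = 0" if "x \<in> B" for x using that B0(3) span_minimal by blast
  moreover have "x \<in> B" if "q x = 0" for x using diff[of x] that by simp
  ultimately show ?thesis using that lin diff by blast
qed

section \<open>Dimension inequalities\<close>

text \<open>\<open>dim\<close> is a cardinality and hence 0 on an infinite-dimensional set; the
  finite spanning set F rules this out.\<close>

lemma finite_dim_basis_exists:
  assumes "W \<subseteq> span F" "finite F"
  obtains B where "B \<subseteq> W" "independent B" "W \<subseteq> span B" "finite B" "card B = dim W"
proof -
  obtain B where "B \<subseteq> W" "independent B" "W \<subseteq> span B" "card B = dim W" using basis_exists by blast
  moreover from this have "finite B" using independent_span_bound[OF assms(2)] assms(1) by blast
  ultimately show ?thesis using that by blast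
qed

lemma dim_mono_finite:
  assumes "V \<subseteq> W" "W \<subseteq> span F" "finite F"
  shows "dim V \<le> dim W"
proof -
  obtain B where "W \<subseteq> span B" "finite B" "card B = dim W"
    by (rule finite_dim_basis_exists[OF assms(2,3)])
  with dim_le_card[of V B] \<open>V \<subseteq> W\<close> show ?thesis by simp
qed

lemma dim_linear_image_le:
  assumes "Vector_Spaces.linear scale scale f" "W \<subseteq> span F" "finite F"
  shows "dim (f ` W) \<le> dim W"
proof -
  interpret f: Vector_Spaces.linear scale scale f by fact
  obtain B where B: "B \<subseteq> W" "W \<subseteq> span B" "finite B" "card B = dim W"
    by (rule finite_dim_basis_exists[OF assms(2,3)])
  then have "f ` W \<subseteq> span (f ` B)" by (metis f.span_image image_mono)
  then have "dim (f ` W) \<le> card (f ` B)" using B(3) by (intro dim_le_card) auto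
  also have "\<dots> \<le> card B" using B(3) by (rule card_image_le)
  finally show ?thesis using B(4) by simp
qed

text \<open>The vectors that extend a basis of V to one of W have images which, together with f
  \<open>V, span f\<close> W. So applying f cannot increase the codimension; this is the source of
  \<open>box_nonneg\<close>.\<close>

lemma dim_linear_image_diff_le:
  assumes lin: "Vector_Spaces.linear scale scale f" and VW: "V \<subseteq> W" and W: "W \<subseteq> span F" and F: "finite F"
  shows "dim (f ` W) + dim V \<le> dim (f ` V) + dim W"
proof -
  interpret f: Vector_Spaces.linear scale scale f by fact
  obtain B1 where B1: "B1 \<subseteq> V" "independent B1" "V \<subseteq> span B1" "card B1 = dim V"
    by (rule finite_dim_basis_exists[OF order_trans[OF VW W] F])
  obtain B2 where B2: "B1 \<subseteq> B2" "B2 \<subseteq> W" "independent B2" "W \<subseteq> span B2"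
    by (rule maximal_independent_subset_extend[OF order_trans[OF B1(1) VW] B1(2)])
  have fin: "finite B2" using independent_span_bound[OF F] B2(2,3) W by blast
  have cardW: "card B2 = dim W" using B2 by (intro basis_card_eq_dim)
  have fV: "f ` V \<subseteq> span (f ` F)" using W VW by (metis f.span_image image_mono order_trans)
  obtain C where C: "f ` V \<subseteq> span C" "finite C" "card C = dim (f ` V)"
    by (rule finite_dim_basis_exists[OF fV finite_imageI[OF F]])
  have "f ` B2 \<subseteq> span (C \<union> f ` (B2 - B1))"
  proof (rule image_subsetI)
    fix b assume "b \<in> B2"
    show "f b \<in> span (C \<union> f ` (B2 - B1))"
    proof (cases "b \<in> B1")
      case True
      then show ?thesis using B1(1) C(1) span_mono[of C "C \<union> f ` (B2 - B1)"] by blast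
    next
      case False
      then show ?thesis using \<open>b \<in> B2\<close> by (intro span_base) auto
    qed
  qed
  then have "f ` W \<subseteq> span (C \<union> f ` (B2 - B1))"
    using B2(4) by (metis f.span_image image_mono order_trans span_minimal subspace_span)
  then have "dim (f ` W) \<le> card (C \<union> f ` (B2 - B1))" using C(2) fin by (intro dim_le_card) auto
  also have "\<dots> \<le> card C + card (B2 - B1)"
    using card_Un_le[of C "f ` (B2 - B1)"] card_image_le[of "B2 - B1" f] fin by simp
  also have "card (B2 - B1) = dim W - dim V"
    using B2(1) fin B1(4) cardW by (metis card_Diff_subset finite_subset)
  finally show ?thesis using C(3) dim_mono_finite[OF VW W F] by simp
qed

section \<open>Transfer to module records\<close>

lemma models_imp_vectorspace:
  assumes U: "subspace U" and "models scale U h V"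
  shows "vectorspace class_ring V"
proof -
  have carrier: "carrier V = h ` U" and zero: "\<zero>\<^bsub>V\<^esub> = h 0"
    and add: "\<And>x y. x \<in> U \<Longrightarrow> y \<in> U \<Longrightarrow> h x \<oplus>\<^bsub>V\<^esub> h y = h (x + y)"
    and smult: "\<And>a x. x \<in> U \<Longrightarrow> a \<odot>\<^bsub>V\<^esub> h x = h (scale a x)"
    using assms by (auto simp: models_def bij_betw_def)
  note closed = subspace_0[OF U] subspace_add[OF U] subspace_scale[OF U] subspace_neg[OF U]
  have group: "abelian_group V"
  proof (rule abelian_groupI)
    fix x assume "x \<in> carrier V"
    then obtain y where "y \<in> U" "x = h y" by (auto simp: carrier)
    then show "\<exists>z\<in>carrier V. z \<oplus>\<^bsub>V\<^esub> x = \<zero>\<^bsub>V\<^esub>"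
      by (intro bexI[of _ "h (- y)"]) (auto simp: carrier zero add closed)
  qed (auto simp: carrier zero add closed ac_simps)
  have "module class_ring V"
    by (rule moduleI[OF class_cring.is_cring group])
      (auto simp: carrier add smult closed scale_left_distrib scale_right_distrib)
  then show ?thesis by (intro vectorspace.intro class_field)
qed

text \<open>h carries a finite basis of U to a basis of V, because linear combinations over subsets
  of the basis correspond under h.\<close>

lemma models_imp_dim_eq:
  assumes U: "subspace U" and models: "models scale U h V" and fin: "U \<subseteq> span F" "finite F"
  shows "vectorspace.dim class_ring V = dim U"
proof -
  have bij: "bij_betw h U (carrier V)" and zero: "\<zero>\<^bsub>V\<^esub> = h 0"
    and add: "\<And>x y. x \<in> U \<Longrightarrow> y \<in> U \<Longrightarrow> h x \<oplus>\<^bsub>V\<^esub> h y = h (x + y)"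
    and smult: "\<And>a x. x \<in> U \<Longrightarrow> a \<odot>\<^bsub>V\<^esub> h x = h (scale a x)"
    using models by (auto simp: models_def)
  have carrier: "carrier V = h ` U" and inj: "inj_on h U" using bij by (auto simp: bij_betw_def)
  interpret V: vectorspace class_ring V using U models by (rule models_imp_vectorspace)
  obtain B where B: "B \<subseteq> U" "independent B" "U \<subseteq> span B" "finite B" "card B = dim U"
    by (rule finite_dim_basis_exists[OF fin])
  have lincomb: "V.lincomb a (h ` A) = h (\<Sum>b\<in>A. scale (a (h b)) b)" if "A \<subseteq> B" for a A
  proof -
    have "finite A" using that B(4) by (rule finite_subset)
    then show ?thesis using that
    proof (induction A rule: finite_induct)
      case empty
      then show ?case by (simp add: V.lincomb_def zero)
    next
      case (insert b A)
      then have in_U: "b \<in> U" "A \<subseteq> U" using B(1) by auto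
      then have "h b \<notin> h ` A" using insert.hyps(2) inj by (auto simp: inj_on_def)
      moreover have "(\<lambda>v. a v \<odot>\<^bsub>V\<^esub> v) \<in> h ` insert b A \<rightarrow> carrier V"
        using in_U by (auto simp: carrier smult subspace_scale[OF U])
      ultimately have "V.lincomb a (h ` insert b A) = a (h b) \<odot>\<^bsub>V\<^esub> h b \<oplus>\<^bsub>V\<^esub> V.lincomb a (h ` A)"
        unfolding V.lincomb_def using insert.hyps(1) by (simp add: Pi_iff)
      also have "\<dots> = h (\<Sum>b\<in>insert b A. scale (a (h b)) b)"
        using insert in_U subspace_sum[OF U, of A] subspace_scale[OF U]
        by (simp add: smult add subset_eq)
      finally show ?case .
    qed
  qed
  have sum_in_U: "(\<Sum>b\<in>A. scale (f b) b) \<in> U" if "A \<subseteq> B" for f A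
    using that B(1) U by (intro subspace_sum subspace_scale) auto
  have "V.basis (h ` B)"
    unfolding V.basis_def
  proof (intro conjI)
    show hB: "h ` B \<subseteq> carrier V" using B(1) carrier by auto
    show "V.gen_set (h ` B)"
    proof (intro equalityI subsetI)
      fix x assume "x \<in> carrier V"
      then obtain y where y: "y \<in> U" "x = h y" using carrier by auto
      then obtain c where c: "y = (\<Sum>b\<in>B. scale (c b) b)"
        using B(3) span_finite[OF B(4)] by auto
      \<comment> \<open>Coefficients in V are indexed by the vectors h b, those in U by b.\<close>
      define a where "a = (\<lambda>v. c (inv_into B h v))"
      have "inj_on h B" using inj B(1) by (rule inj_on_subset)
      then have "V.lincomb a (h ` B) = x"
        unfolding lincomb[OF order_refl] y(2) c by (simp add: a_def)
      then show "x \<in> V.span (h ` B)" unfolding V.span_def using B(4) by auto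
    next
      show "x \<in> carrier V" if "x \<in> V.span (h ` B)" for x
        using V.span_is_subset2[OF hB] that by blast
    qed
    show "V.lin_indpt (h ` B)"
    proof
      assume "V.lin_dep (h ` B)"
      then obtain A' a v where A': "finite A'" "A' \<subseteq> h ` B" "V.lincomb a A' = \<zero>\<^bsub>V\<^esub>" "v \<in> A'" "a v \<noteq> 0"
        unfolding V.lin_dep_def by auto
      obtain A where A: "A \<subseteq> B" "A' = h ` A" using A'(2) by (meson subset_imageE)
      have "h (\<Sum>b\<in>A. scale (a (h b)) b) = h 0" using lincomb[OF A(1)] A(2) A'(3) zero by simp
      then have 0: "(\<Sum>b\<in>A. scale (a (h b)) b) = 0"
        using inj sum_in_U[OF A(1)] subspace_0[OF U] by (auto simp: inj_on_def)
      obtain b where "b \<in> A" "v = h b" using A'(4) A(2) by auto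
      moreover have "\<forall>b\<in>A. a (h b) = 0"
        using B(2)[unfolded independent_explicit_finite_subsets, rule_format, of A "\<lambda>b. a (h b)"]
          0 A(1) finite_subset[OF A(1) B(4)] by blast
      ultimately show False using A'(5) by blast
    qed
  qed
  then have "V.dim = card (h ` B)" using B(4) by (intro V.dim_basis) auto
  also have "\<dots> = dim U" using B(1,5) inj by (metis card_image inj_on_subset)
  finally show ?thesis .
qed

end

text \<open>A basis of W injects into a basis of U; g inverts this injection and kills the remaining
  basis vectors.\<close>

lemma (in vector_space_pair) linear_surjection_exists:
  assumes U: "vs1.subspace U" "U \<subseteq> vs1.span F" "finite F"
    and W: "vs2.subspace W" "W \<subseteq> vs2.span G" "finite G"
    and dim: "vs2.dim W \<le> vs1.dim U"
  obtains g where "Vector_Spaces.linear s1 s2 g" "g ` U = W"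
proof -
  obtain B where B: "B \<subseteq> U" "vs1.independent B" "U \<subseteq> vs1.span B" "finite B" "card B = vs1.dim U"
    by (rule vs1.finite_dim_basis_exists[OF U(2,3)])
  obtain C where C: "C \<subseteq> W" "W \<subseteq> vs2.span C" "finite C" "card C = vs2.dim W"
    by (rule vs2.finite_dim_basis_exists[OF W(2,3)])
  obtain i where i: "inj_on i C" "i ` C \<subseteq> B"
    using card_le_inj[OF C(3) B(4)] B(5) C(4) dim by auto
  define g where "g = construct B (\<lambda>b. if b \<in> i ` C then inv_into C i b else 0)"
  have lin: "Vector_Spaces.linear s1 s2 g" unfolding g_def by (rule linear_construct) fact
  interpret g: Vector_Spaces.linear s1 s2 g by fact
  have g: "g b = (if b \<in> i ` C then inv_into C i b else 0)" if "b \<in> B" for b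
    unfolding g_def using B(2) that by (rule construct_basis)
  have "U = vs1.span B" using B(1,3) U(1) by (simp add: vs1.span_minimal subset_antisym)
  then have "g ` U = vs2.span (g ` B)" by (simp add: g.span_image)
  also have "\<dots> = W"
  proof
    have "g ` B \<subseteq> W" using g C(1) i W(1) by (auto simp: vs2.subspace_0)
    then show "vs2.span (g ` B) \<subseteq> W" using W(1) by (rule vs2.span_minimal)
    have "c \<in> g ` B" if "c \<in> C" for c
      using that i g[of "i c"] by (intro image_eqI[of _ _ "i c"]) auto
    then have "vs2.span C \<subseteq> vs2.span (g ` B)" by (intro vs2.span_mono) auto
    then show "W \<subseteq> vs2.span (g ` B)" using C(2) by simp
  qed
  finally show ?thesis using that lin by blast
qed

text \<open>The subgroup is all of V, and the epimorphism is the linear surjection of the models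
  conjugated by h and h'.\<close>

lemma (in vector_space_pair) subgroup_surjects_of_dim_le:
  fixes V :: "('a, 'd) module" and V' :: "('a, 'e) module"
  assumes U: "vs1.subspace U" and W: "vs2.subspace W"
    and models: "models s1 U h V" "models s2 W h' V'"
    and fin: "U \<subseteq> vs1.span F" "finite F" "W \<subseteq> vs2.span G" "finite G" "vs2.dim W \<le> vs1.dim U"
  shows "subgroup_surjects V V'"
proof -
  have bij: "bij_betw h U (carrier V)" "bij_betw h' W (carrier V')"
    using models by (auto simp: models_def models_def)
  obtain g where g: "Vector_Spaces.linear s1 s2 g" "g ` U = W"
    by (rule linear_surjection_exists[OF U fin(1,2) W fin(3-)])
  interpret g: Vector_Spaces.linear s1 s2 g by fact
  interpret V: vectorspace class_ring V using U models(1) by (rule vs1.models_imp_vectorspace)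
  define i where "i = inv_into U h"
  have i: "i (h x) = x" if "x \<in> U" for x
    using bij(1) that by (auto simp: i_def bij_betw_def)
  have carrier: "carrier V = h ` U" "carrier V' = h' ` W" using bij by (auto simp: bij_betw_def)
  have "h' \<circ> g \<circ> i \<in> epi (add_monoid V) (add_monoid V')"
    unfolding epi_def mem_Collect_eq
  proof
    show "h' \<circ> g \<circ> i \<in> hom (add_monoid V) (add_monoid V')"
    proof (rule homI)
      fix x y assume "x \<in> carrier (add_monoid V)" "y \<in> carrier (add_monoid V)"
      then obtain x' y' where xy: "x' \<in> U" "y' \<in> U" "x = h x'" "y = h y'" by (auto simp: carrier)
      have "g x' \<in> W" "g y' \<in> W" "x' + y' \<in> U" using g(2) xy U by (auto simp: vs1.subspace_add)
      moreover have "x \<oplus>\<^bsub>V\<^esub> y = h (x' + y')" using models(1) xy by (auto simp: models_def)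
      ultimately show "(h' \<circ> g \<circ> i) (x \<otimes>\<^bsub>add_monoid V\<^esub> y) = (h' \<circ> g \<circ> i) x \<otimes>\<^bsub>add_monoid V'\<^esub> (h' \<circ> g \<circ> i) y"
        using models(2) xy by (simp add: models_def i g.add)
    qed (use g(2) i in \<open>auto simp: carrier\<close>)
    show "(h' \<circ> g \<circ> i) ` carrier (add_monoid V) = carrier (add_monoid V')"
      using i g(2) by (auto simp: carrier image_iff)
  qed
  moreover have "subgroup (carrier V) (add_monoid V)"
    using group.subgroup_self[OF V.a_group] by simp
  moreover have "(add_monoid V)\<lparr>carrier := carrier V\<rparr> = add_monoid V" by simp
  ultimately show ?thesis unfolding subgroup_surjects_def by metis
qed

section \<open>Chains with field coefficients\<close>

text \<open>This is the scalar multiplication of \<open>field_chain_space\<close>, under a name with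
  which \<open>vector_space\<close> can be interpreted.\<close>

definition fscale :: "'f::field \<Rightarrow> ('s \<Rightarrow>\<^sub>0 'f) \<Rightarrow> ('s \<Rightarrow>\<^sub>0 'f)" where
  "fscale a = Poly_Mapping.map (\<lambda>b. a * b)"

lemma lookup_fscale [simp]: "Poly_Mapping.lookup (fscale a c) s = a * Poly_Mapping.lookup c s"
  by (simp add: fscale_def Poly_Mapping.map.rep_eq when_def)

interpretation fc: vector_space fscale
  by (unfold_locales; rule poly_mapping_eqI; simp add: lookup_add algebra_simps)

interpretation fc_pair: vector_space_pair fscale fscale ..

lemma linear_fscaleI:
  assumes "\<And>x y. f (x + y) = f x + f y" "\<And>a x. f (fscale a x) = fscale a (f x)"
  shows "Vector_Spaces.linear fscale fscale f"
  unfolding Vector_Spaces.linear_iff using assms by (simp add: fc.vector_space_axioms)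

lemma keys_fscale: "Poly_Mapping.keys (fscale a c) \<subseteq> Poly_Mapping.keys c"
  by (auto simp: in_keys_iff)

lemma fscale_single: "fscale a (Poly_Mapping.single s b) = Poly_Mapping.single s (a * b)"
  by (rule poly_mapping_eqI) (simp add: lookup_single when_def)

lemma subspace_keys: "fc.subspace {c. Poly_Mapping.keys c \<subseteq> S}"
proof (rule fc.subspaceI)
  show "x + y \<in> {c. Poly_Mapping.keys c \<subseteq> S}"
    if "x \<in> {c. Poly_Mapping.keys c \<subseteq> S}" "y \<in> {c. Poly_Mapping.keys c \<subseteq> S}" for x y
    using that keys_add[of x y] by blast
  show "fscale a x \<in> {c. Poly_Mapping.keys c \<subseteq> S}" if "x \<in> {c. Poly_Mapping.keys c \<subseteq> S}" for a x
    using that keys_fscale[of a x] by blast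
qed simp

section \<open>Extending integral operators to field coefficients\<close>

definition of_chain :: "('s \<Rightarrow>\<^sub>0 int) \<Rightarrow> ('s \<Rightarrow>\<^sub>0 'f::field)" where
  "of_chain = Poly_Mapping.map of_int"

lemma lookup_of_chain [simp]: "Poly_Mapping.lookup (of_chain z) s = of_int (Poly_Mapping.lookup z s)"
  by (simp add: of_chain_def Poly_Mapping.map.rep_eq when_def)

lemma of_chain_0 [simp]: "of_chain 0 = 0"
  and of_chain_add: "of_chain (y + z) = of_chain y + of_chain z"
  and of_chain_diff: "of_chain (y - z) = of_chain y - of_chain z"
  and of_chain_frag_of: "of_chain (frag_of s) = Poly_Mapping.single s 1"
  and of_chain_frag_cmul: "of_chain (frag_cmul m z) = fscale (of_int m) (of_chain z)"
  by (rule poly_mapping_eqI; simp add: lookup_add lookup_minus lookup_single when_def)+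

lemma of_chain_sum: "of_chain (sum f I) = (\<Sum>i\<in>I. of_chain (f i))"
  by (induction I rule: infinite_finite_induct) (auto simp: of_chain_add)

text \<open>Only an inclusion: coefficients divisible by the characteristic of the field
  vanish.\<close>

lemma keys_of_chain: "Poly_Mapping.keys (of_chain z) \<subseteq> Poly_Mapping.keys z"
  by (auto simp: in_keys_iff)

text \<open>This extension transfers identities between the integral chain operators of \<^theory>\<open>HOL-Homology.Simplices\<close>
  to field coefficients.\<close>

definition field_extend :: "('s \<Rightarrow> 't \<Rightarrow>\<^sub>0 int) \<Rightarrow> ('s \<Rightarrow>\<^sub>0 'f) \<Rightarrow> ('t \<Rightarrow>\<^sub>0 'f::field)" where
  "field_extend f c = (\<Sum>s\<in>Poly_Mapping.keys c. fscale (Poly_Mapping.lookup c s) (of_chain (f s)))"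

lemma field_extend_superset:
  assumes "finite S" "Poly_Mapping.keys c \<subseteq> S"
  shows "field_extend f c = (\<Sum>s\<in>S. fscale (Poly_Mapping.lookup c s) (of_chain (f s)))"
  unfolding field_extend_def using assms
  by (intro sum.mono_neutral_left) (auto simp: in_keys_iff)

lemma linear_field_extend:
  fixes f :: "'s \<Rightarrow> 't \<Rightarrow>\<^sub>0 int"
  shows "Vector_Spaces.linear fscale fscale (field_extend f :: ('s \<Rightarrow>\<^sub>0 'f::field) \<Rightarrow> _)"
proof (rule linear_fscaleI)
  fix a b :: "'s \<Rightarrow>\<^sub>0 'f"
  let ?S = "Poly_Mapping.keys a \<union> Poly_Mapping.keys b"
  have "Poly_Mapping.keys (a + b) \<subseteq> ?S" by (rule keys_add)
  then show "field_extend f (a + b) = field_extend f a + field_extend f b"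
    by (simp add: field_extend_superset[where S = ?S] lookup_add fc.scale_left_distrib sum.distrib)
next
  fix r :: 'f and a :: "'s \<Rightarrow>\<^sub>0 'f"
  have "Poly_Mapping.keys (fscale r a) \<subseteq> Poly_Mapping.keys a" by (rule keys_fscale)
  then show "field_extend f (fscale r a) = fscale r (field_extend f a)"
    by (simp add: field_extend_superset[where S = "Poly_Mapping.keys a"] fc.scale_sum_right)
qed

interpretation field_extend: Vector_Spaces.linear fscale fscale "field_extend f" for f
  by (rule linear_field_extend)

lemma field_extend_single: "field_extend f (Poly_Mapping.single s a) = fscale a (of_chain (f s))"
  by (subst field_extend_superset[where S = "{s}"]) auto

lemma field_extend_cong:
  "(\<And>s. s \<in> Poly_Mapping.keys c \<Longrightarrow> f s = g s) \<Longrightarrow> field_extend f c = field_extend g c"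
  by (simp add: field_extend_def)

lemma field_extend_diff_fun: "field_extend (\<lambda>s. f s - g s) c = field_extend f c - field_extend g c"
  by (simp add: field_extend_def of_chain_diff fc.scale_right_diff_distrib sum_subtractf)

lemma field_extend_zero_fun: "field_extend (\<lambda>s. 0) c = 0"
  by (simp add: field_extend_def)

lemma field_extend_frag_of: "field_extend frag_of c = c"
proof (rule poly_mapping_eqI)
  fix t
  have "Poly_Mapping.lookup (field_extend frag_of c) t
      = (\<Sum>s\<in>Poly_Mapping.keys c. if t = s then Poly_Mapping.lookup c s else 0)"
    by (simp add: field_extend_def of_chain_frag_of fscale_single lookup_sum lookup_single when_def
      eq_commute cong: if_cong)
  then show "Poly_Mapping.lookup (field_extend frag_of c) t = Poly_Mapping.lookup c t"
    by (simp add: in_keys_iff)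
qed

lemma keys_field_extend:
  "Poly_Mapping.keys (field_extend f c) \<subseteq> (\<Union>s\<in>Poly_Mapping.keys c. Poly_Mapping.keys (f s))"
proof -
  have "Poly_Mapping.keys (field_extend f c) \<subseteq>
      (\<Union>s\<in>Poly_Mapping.keys c. Poly_Mapping.keys (fscale (Poly_Mapping.lookup c s) (of_chain (f s))))"
    unfolding field_extend_def by (rule keys_sum)
  then show ?thesis
    by (rule order_trans) (intro UN_mono order_refl order_trans[OF keys_fscale keys_of_chain])
qed

lemma field_extend_of_chain: "field_extend f (of_chain z) = of_chain (frag_extend f z)"
proof (induction z rule: frag_induction[OF subset_UNIV])
  case (2 s)
  then show ?case by (simp add: of_chain_frag_of field_extend_single)
next
  case (3 a b)
  then show ?case by (simp add: of_chain_diff frag_extend_diff field_extend.diff)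
qed (simp add: field_extend.zero)

text \<open>A composite of extended operators is determined by the integral composite on generators,
  so operator identities need checking only on single simplices.\<close>

lemma field_extend_field_extend:
  "field_extend f (field_extend g c) = field_extend (\<lambda>s. frag_extend f (g s)) c"
  by (simp add: field_extend_def[of g] field_extend_def[of "\<lambda>s. frag_extend f (g s)"]
      field_extend.sum field_extend.scale field_extend_of_chain)

text \<open>Brings operators known only to be additive, such as subdivision homotopies, into the
  form that composes with \<open>field_extend\<close>.\<close>

lemma additive_eq_frag_extend:
  fixes F :: "('s \<Rightarrow>\<^sub>0 int) \<Rightarrow> ('t \<Rightarrow>\<^sub>0 int)"
  assumes "F 0 = 0" "\<And>a b. F (a - b) = F a - F b"
  shows "F z = frag_extend (\<lambda>s. F (frag_of s)) z"
  by (induction z rule: frag_induction[OF subset_UNIV]) (simp_all add: assms frag_extend_diff)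

section \<open>Field chains and their boundary\<close>

definition field_chains :: "nat \<Rightarrow> 'a topology \<Rightarrow> ('a, 'f::field) field_chain set" where
  "field_chains n X = {c. Poly_Mapping.keys c \<subseteq> singular_simplex_set n X}"

abbreviation bd :: "nat \<Rightarrow> ('a, 'f::field) field_chain \<Rightarrow> ('a, 'f) field_chain" where
  "bd n \<equiv> field_extend (\<lambda>s. chain_boundary n (frag_of s))"

text \<open>For k \<le> 0 both sides vanish, since nat k = 0 and the integral boundary in degree 0
  is zero.\<close>

lemma field_boundary_eq: "field_boundary k c = bd (nat k) c"
proof (cases "k \<le> 0")
  case True
  then show ?thesis by (simp add: field_boundary_def chain_boundary_def field_extend_zero_fun)
next
  case False
  then show ?thesis
    by (simp add: field_boundary_def field_extend_def chain_boundary_def of_chain_sum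
        of_chain_frag_cmul of_chain_frag_of fscale_single fc.scale_sum_right mult.commute)
qed

lemma frag_extend_chain_boundary: "frag_extend (\<lambda>s. chain_boundary n (frag_of s)) z = chain_boundary n z"
  by (rule additive_eq_frag_extend[symmetric]) (simp_all add: chain_boundary_diff)

lemma bd_field_extend: "bd n (field_extend f c) = field_extend (\<lambda>s. chain_boundary n (f s)) c"
  by (simp add: field_extend_field_extend frag_extend_chain_boundary)

lemma field_extend_in_field_chains:
  assumes "\<And>s. s \<in> Poly_Mapping.keys c \<Longrightarrow> singular_chain m Y (f s)"
  shows "field_extend f c \<in> field_chains m Y"
  unfolding field_chains_def mem_Collect_eq
  by (rule order_trans[OF keys_field_extend UN_least]) (use assms in \<open>simp add: singular_chain_def\<close>)

lemma singular_simplex_of_field_chains: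
  "c \<in> field_chains n X \<Longrightarrow> s \<in> Poly_Mapping.keys c \<Longrightarrow> singular_simplex n X s"
  by (auto simp: field_chains_def)

lemma bd_in_field_chains:
  assumes "c \<in> field_chains (Suc n) X"
  shows "bd (Suc n) c \<in> field_chains n X"
  using assms by (intro field_extend_in_field_chains singular_chain_boundary_alt)
    (auto simp: singular_chain_of singular_simplex_of_field_chains)

lemma bd_bd:
  assumes "c \<in> field_chains (Suc n) X"
  shows "bd n (bd (Suc n) c) = 0"
proof -
  have "bd n (bd (Suc n) c) = field_extend (\<lambda>s. 0) c"
    unfolding bd_field_extend
    using assms by (intro field_extend_cong chain_boundary_boundary_alt[of n X])
      (auto simp: singular_chain_of singular_simplex_of_field_chains)
  then show ?thesis by (simp add: field_extend_zero_fun)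
qed

text \<open>Linear extension of the homotopy identity leaves the extra term H' (bd n c), which
  vanishes on a cycle. H' is the part of the homotopy one dimension lower.\<close>

lemma bd_chain_homotopy:
  assumes "bd n c = 0"
    and "\<And>s. s \<in> Poly_Mapping.keys c \<Longrightarrow>
      chain_boundary (Suc n) (H s) + frag_extend H' (chain_boundary n (frag_of s)) = S s - frag_of s"
  shows "bd (Suc n) (field_extend H c) = field_extend S c - c"
proof -
  have "bd (Suc n) (field_extend H c)
      = field_extend (\<lambda>s. (S s - frag_of s) - frag_extend H' (chain_boundary n (frag_of s))) c"
    unfolding bd_field_extend using assms(2)
    by (intro field_extend_cong) (metis add_diff_cancel_right')
  also have "\<dots> = field_extend S c - c - field_extend H' (bd n c)"
    by (simp add: field_extend_diff_fun field_extend_frag_of field_extend_field_extend)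
  finally show ?thesis using assms(1) by (simp add: field_extend.zero)
qed

section \<open>Straightening small simplices\<close>

text \<open>The straight-line homotopy makes c homologous to its image under the constant map to a.
  In positive degree this image bounds because a point has no homology there; in degree 0 its
  vanishing says that c has augmentation zero.\<close>

lemma convex_imp_cycle_is_boundary:
  fixes C :: "'e::real_normed_vector set"
  assumes "convex C" and c: "singular_chain n (top_of_set C) c" "chain_boundary n c = 0"
    and a: "a \<in> C" "n = 0 \<Longrightarrow> chain_map 0 (\<lambda>x. a) c = 0"
  obtains d where "singular_chain (Suc n) (top_of_set C) d" "chain_boundary (Suc n) d = c"
proof -
  have cycle: "singular_relcycle n (top_of_set C) {} c" using c by (simp add: singular_cycle)
  have "homotopic_with_canon (\<lambda>h. True) C C id (\<lambda>x. a)"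
    using \<open>convex C\<close> a(1) by (intro homotopic_with_linear) (auto simp: convex_contains_segment)
  then have "homologous_rel n (top_of_set C) {} (chain_map n id c) (chain_map n (\<lambda>x. a) c)"
    using cycle by (intro homotopic_imp_homologous_rel_chain_maps[of "{}" "{}" "top_of_set C"]) auto
  then have 1: "singular_relboundary n (top_of_set C) {} (c - chain_map n (\<lambda>x. a) c)"
    using chain_map_ident[OF c(1)] by (simp add: homologous_rel_def)
  have "singular_relboundary n (top_of_set C) {} (chain_map n (\<lambda>x. a) c)"
  proof (cases "n = 0")
    case True
    then show ?thesis using a(2) by simp
  next
    case False
    have "singular_relcycle n (top_of_set {a}) {} (chain_map n (\<lambda>x. a) c)"
      using singular_relcycle_chain_map[OF cycle, of "top_of_set {a}" "\<lambda>x. a" "{}"] by simp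
    then have "singular_relboundary n (top_of_set {a}) {} (chain_map n (\<lambda>x. a) c)"
      using False singular_boundary_eq_cycle_singleton[of "top_of_set {a}" a n] by simp
    then show ?thesis using a(1) by (intro singular_boundary_mono[of "{a}" C]) auto
  qed
  with 1 have "singular_relboundary n (top_of_set C) {} c"
    using singular_relboundary_add[OF 1] by fastforce
  then show ?thesis using that by (auto simp: singular_boundary)
qed

lemma frag_extend_chain_boundary_carrier:
  assumes \<sigma>: "singular_simplex (Suc n) X \<sigma>"
    and D: "\<And>\<tau>. singular_simplex n X \<tau> \<Longrightarrow> singular_chain m (Y \<tau>) (D \<tau>)"
    and sub: "\<And>i c. i \<le> Suc n \<Longrightarrow> singular_chain m (Y (singular_face (Suc n) i \<sigma>)) c \<Longrightarrow> singular_chain m Z c"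
  shows "singular_chain m Z (frag_extend D (chain_boundary (Suc n) (frag_of \<sigma>)))"
proof -
  have "singular_chain m Z (D (singular_face (Suc n) i \<sigma>))" if "i \<le> Suc n" for i
    using sub[OF that] D singular_simplex_singular_face[OF \<sigma>, of i] that by simp
  then have "singular_chain m Z (\<Sum>i\<le>Suc n. frag_cmul ((-1) ^ i) (D (singular_face (Suc n) i \<sigma>)))"
    by (intro singular_chain_sum singular_chain_cmul) simp
  then show ?thesis
    by (simp add: chain_boundary_of frag_extend_sum frag_extend_cmul o_def del: sum.atMost_Suc)
qed

lemma chain_boundary_frag_of_natural:
  assumes "\<And>i. i \<le> n \<Longrightarrow> 0 < n \<Longrightarrow> T (n - 1) (singular_face n i \<sigma>) = singular_face n i (T n \<sigma>)"
  shows "chain_boundary n (frag_of (T n \<sigma>)) = frag_extend (frag_of \<circ> T (n - 1)) (chain_boundary n (frag_of \<sigma>))"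
proof (cases "n = 0")
  case False
  then show ?thesis
    using assms by (simp add: chain_boundary_of frag_extend_sum frag_extend_cmul o_def)
qed (simp add: chain_boundary_def)

text \<open>The method of acyclic carriers: convex sets have no homology, so the homotopy can be built simplex by
  simplex, by induction on the dimension.\<close>

lemma convex_carrier_chain_homotopy:
  fixes T :: "nat \<Rightarrow> ((nat \<Rightarrow> real) \<Rightarrow> 'e::real_normed_vector) \<Rightarrow> (nat \<Rightarrow> real) \<Rightarrow> 'e"
  assumes convex: "\<And>n \<sigma>. convex (C n \<sigma>)"
    and id: "\<And>n \<sigma>. singular_simplex n euclidean \<sigma> \<Longrightarrow> singular_simplex n (top_of_set (C n \<sigma>)) \<sigma>"
    and T: "\<And>n \<sigma>. singular_simplex n euclidean \<sigma> \<Longrightarrow> singular_simplex n (top_of_set (C n \<sigma>)) (T n \<sigma>)"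
    and faces: "\<And>n \<sigma> i. singular_simplex (Suc n) euclidean \<sigma> \<Longrightarrow> i \<le> Suc n \<Longrightarrow>
        C n (singular_face (Suc n) i \<sigma>) \<subseteq> C (Suc n) \<sigma>"
    and T_faces: "\<And>n \<sigma> i. singular_simplex (Suc n) euclidean \<sigma> \<Longrightarrow> i \<le> Suc n \<Longrightarrow>
        T n (singular_face (Suc n) i \<sigma>) = singular_face (Suc n) i (T (Suc n) \<sigma>)"
  shows "\<exists>D. \<forall>n \<sigma>. singular_simplex n euclidean \<sigma> \<longrightarrow> singular_chain (Suc n) (top_of_set (C n \<sigma>)) (D n \<sigma>) \<and>
        chain_boundary (Suc n) (D n \<sigma>) + frag_extend (D (n - 1)) (chain_boundary n (frag_of \<sigma>))
          = frag_of (T n \<sigma>) - frag_of \<sigma>"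
proof -
  let ?simp = "\<lambda>n. singular_simplex n (euclidean :: 'e topology)"
  \<comment> \<open>P mentions the operator one dimension lower only existentially, so that it is a
    predicate on a single D; Q links consecutive choices.\<close>
  define P where "P n D \<longleftrightarrow> (\<forall>\<sigma>. ?simp n \<sigma> \<longrightarrow> singular_chain (Suc n) (top_of_set (C n \<sigma>)) (D \<sigma>)) \<and>
     (\<exists>D'. \<forall>\<sigma>. ?simp n \<sigma> \<longrightarrow> chain_boundary (Suc n) (D \<sigma>) + frag_extend D' (chain_boundary n (frag_of \<sigma>))
          = frag_of (T n \<sigma>) - frag_of \<sigma>)" for n D
  define Q where "Q n D' D \<longleftrightarrow> (\<forall>\<sigma>. ?simp (Suc n) \<sigma> \<longrightarrow>
      chain_boundary (Suc (Suc n)) (D \<sigma>) + frag_extend D' (chain_boundary (Suc n) (frag_of \<sigma>))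
          = frag_of (T (Suc n) \<sigma>) - frag_of \<sigma>)" for n D' D
  have in_C: "singular_chain n (top_of_set (C n \<sigma>)) (frag_of (T n \<sigma>) - frag_of \<sigma>)"
    if "?simp n \<sigma>" for n \<sigma>
    using id[OF that] T[OF that] by (intro singular_chain_diff) (auto simp: singular_chain_of)
  have nonempty: "\<exists>a. a \<in> C n \<sigma>" if "?simp n \<sigma>" for n \<sigma>
  proof (rule ccontr)
    assume "\<nexists>a. a \<in> C n \<sigma>"
    then have "topspace (top_of_set (C n \<sigma>)) = {}" by auto
    then show False using singular_simplex_empty id[OF that] by metis
  qed
  \<comment> \<open>Both 0-simplices go to the same constant simplex, so their difference has
    augmentation zero.\<close>
  have 0: "\<exists>d. singular_chain (Suc 0) (top_of_set (C 0 \<sigma>)) d \<and> chain_boundary (Suc 0) d = frag_of (T 0 \<sigma>) - frag_of \<sigma>"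
    if \<sigma>: "?simp 0 \<sigma>" for \<sigma>
  proof -
    obtain a where a: "a \<in> C 0 \<sigma>" using nonempty[OF \<sigma>] by blast
    have "chain_map 0 (\<lambda>x. a) (frag_of (T 0 \<sigma>) - frag_of \<sigma>) = 0"
      by (simp add: chain_map_diff simplex_map_def o_def)
    then show ?thesis
      using convex_imp_cycle_is_boundary[OF convex in_C[OF \<sigma>] _ a] by (auto simp: chain_boundary_def)
  qed
  have step: "\<exists>d. singular_chain (Suc (Suc n)) (top_of_set (C (Suc n) \<sigma>)) d \<and>
      chain_boundary (Suc (Suc n)) d = frag_of (T (Suc n) \<sigma>) - frag_of \<sigma> - frag_extend D (chain_boundary (Suc n) (frag_of \<sigma>))"
    if P: "P n D" and \<sigma>: "?simp (Suc n) \<sigma>" for n D \<sigma>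
  proof -
    obtain a where a: "a \<in> C (Suc n) \<sigma>" using nonempty[OF \<sigma>] by blast
    obtain D' where D': "\<And>\<tau>. ?simp n \<tau> \<Longrightarrow>
        chain_boundary (Suc n) (D \<tau>) + frag_extend D' (chain_boundary n (frag_of \<tau>)) = frag_of (T n \<tau>) - frag_of \<tau>"
      using P by (auto simp: P_def)
    have D'_chain: "chain_boundary (Suc n) (frag_extend D c) + frag_extend D' (chain_boundary n c)
        = frag_extend (frag_of \<circ> T n) c - c" if "singular_chain n (euclidean :: 'e topology) c" for c
      using that[unfolded singular_chain_def]
    proof (induction c rule: frag_induction)
      case (one \<tau>)
      then show ?case using D'[of \<tau>] by simp
    next
      case (diff x y)
      have "chain_boundary (Suc n) (frag_extend D (x - y)) + frag_extend D' (chain_boundary n (x - y))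
          = (frag_extend (frag_of \<circ> T n) x - x) - (frag_extend (frag_of \<circ> T n) y - y)"
        unfolding diff[symmetric] by (simp only: frag_extend_diff chain_boundary_diff add_diff_add)
      also have "\<dots> = frag_extend (frag_of \<circ> T n) (x - y) - (x - y)"
        by (simp add: frag_extend_diff)
      finally show ?case .
    qed simp
    let ?b = "chain_boundary (Suc n) (frag_of \<sigma>)"
    \<comment> \<open>What the new homotopy has to fill. It is a cycle: T commutes with the
      boundary, and the previous identity evaluates the boundary of the last term because ?b is a
      cycle.\<close>
    let ?c = "frag_of (T (Suc n) \<sigma>) - frag_of \<sigma> - frag_extend D ?b"
    have b: "singular_chain n (euclidean :: 'e topology) ?b"
      using \<sigma> by (intro singular_chain_boundary_alt) (simp add: singular_chain_of)
    have "singular_chain (Suc n) (top_of_set (C (Suc n) \<sigma>)) (frag_extend D ?b)"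
    proof (rule frag_extend_chain_boundary_carrier[OF \<sigma>, where Y = "\<lambda>\<tau>. top_of_set (C n \<tau>)"])
      show "singular_chain (Suc n) (top_of_set (C n \<tau>)) (D \<tau>)" if "?simp n \<tau>" for \<tau>
        using that P by (simp add: P_def)
      show "singular_chain (Suc n) (top_of_set (C n (singular_face (Suc n) i \<sigma>))) c \<Longrightarrow>
          singular_chain (Suc n) (top_of_set (C (Suc n) \<sigma>)) c" if "i \<le> Suc n" for i c
        using faces[OF \<sigma> that] by (metis singular_chain_mono)
    qed
    then have 1: "singular_chain (Suc n) (top_of_set (C (Suc n) \<sigma>)) ?c"
      using in_C[OF \<sigma>] by (rule singular_chain_diff[rotated])
    have bb: "chain_boundary n ?b = 0"
      using \<sigma> by (intro chain_boundary_boundary_alt[of n euclidean]) (simp add: singular_chain_of)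
    have "chain_boundary (Suc n) (frag_of (T (Suc n) \<sigma>)) = frag_extend (frag_of \<circ> T n) ?b"
      using chain_boundary_frag_of_natural[of "Suc n" T \<sigma>] T_faces[OF \<sigma>] by simp
    moreover have "chain_boundary (Suc n) (frag_extend D ?b) = frag_extend (frag_of \<circ> T n) ?b - ?b"
      using D'_chain[OF b] bb by simp
    ultimately have 2: "chain_boundary (Suc n) ?c = 0"
      by (simp add: chain_boundary_diff)
    show ?thesis using convex_imp_cycle_is_boundary[OF convex 1 2 a] by blast
  qed
  have "\<exists>D. \<forall>n. P n (D n) \<and> Q n (D n) (D (Suc n))"
  proof (rule dependent_nat_choice)
    obtain d where "\<And>\<sigma>. ?simp 0 \<sigma> \<Longrightarrow> singular_chain (Suc 0) (top_of_set (C 0 \<sigma>)) (d \<sigma>) \<and>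
        chain_boundary (Suc 0) (d \<sigma>) = frag_of (T 0 \<sigma>) - frag_of \<sigma>"
      using 0 by metis
    then have "P 0 d" by (auto simp: P_def chain_boundary_def)
    then show "\<exists>D. P 0 D" by (rule exI[of _ d])
  next
    fix D n assume P: "P n D"
    obtain d where d: "\<And>\<sigma>. ?simp (Suc n) \<sigma> \<Longrightarrow> singular_chain (Suc (Suc n)) (top_of_set (C (Suc n) \<sigma>)) (d \<sigma>) \<and>
        chain_boundary (Suc (Suc n)) (d \<sigma>) = frag_of (T (Suc n) \<sigma>) - frag_of \<sigma> - frag_extend D (chain_boundary (Suc n) (frag_of \<sigma>))"
      using step[OF P] by metis
    then have "Q n D d" by (simp add: Q_def)
    moreover from this d have "P (Suc n) d" unfolding P_def Q_def by blast
    ultimately show "\<exists>d. P (Suc n) d \<and> Q n D d" by blast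
  qed
  then obtain D where D: "\<And>n. P n (D n)" "\<And>n. Q n (D n) (D (Suc n))" by blast
  show ?thesis
  proof (intro exI[of _ D] allI impI conjI)
    show "singular_chain (Suc n) (top_of_set (C n \<sigma>)) (D n \<sigma>)" if "?simp n \<sigma>" for n \<sigma>
      using D(1)[of n] that by (simp add: P_def)
    show "chain_boundary (Suc n) (D n \<sigma>) + frag_extend (D (n - 1)) (chain_boundary n (frag_of \<sigma>))
          = frag_of (T n \<sigma>) - frag_of \<sigma>" if "?simp n \<sigma>" for n \<sigma>
    proof (cases n)
      case 0
      then show ?thesis using D(1)[of 0] that by (auto simp: P_def chain_boundary_def)
    next
      case (Suc m)
      then show ?thesis using D(2)[of m] that by (simp add: Q_def)
    qed
  qed
qed

section \<open>Straight simplices\<close>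

text \<open>The restriction makes this a singular simplex in the extensional sense, and makes it
  depend on l 0, ..., l n only, so that finitely many vertices give finitely many simplices.\<close>

definition straight_simplex :: "nat \<Rightarrow> (nat \<Rightarrow> 'e::real_normed_vector) \<Rightarrow> (nat \<Rightarrow> real) \<Rightarrow> 'e" where
  "straight_simplex n l = restrict (\<lambda>x. \<Sum>j\<le>n. x j *\<^sub>R l j) (standard_simplex n)"

abbreviation simplex_vertex :: "nat \<Rightarrow> nat \<Rightarrow> real" where
  "simplex_vertex j \<equiv> (\<lambda>i. if i = j then 1 else 0)"

lemma singular_simplex_straight_simplex:
  fixes l :: "nat \<Rightarrow> 'e::real_normed_vector"
  assumes "convex C" "\<And>j. j \<le> n \<Longrightarrow> l j \<in> C"
  shows "singular_simplex n (top_of_set C) (straight_simplex n l)"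
proof -
  have "continuous_on (standard_simplex n) (\<lambda>x. \<Sum>j\<le>n. x j *\<^sub>R l j)"
    by (intro continuous_intros continuous_on_product_then_coordinatewise[OF continuous_on_id])
  moreover have "(\<Sum>j\<le>n. x j *\<^sub>R l j) \<in> C" if "x \<in> standard_simplex n" for x
    using that assms by (intro convex_sum) (auto simp: standard_simplex_def)
  ultimately have "continuous_map (top_of_set (standard_simplex n)) (top_of_set C) (\<lambda>x. \<Sum>j\<le>n. x j *\<^sub>R l j)"
    by (auto simp: continuous_map_in_subtopology)
  then show ?thesis
    unfolding singular_simplex_def straight_simplex_def euclidean_product_topology
    by (auto elim!: continuous_map_eq)
qed

text \<open>The face map inserts a zero coordinate at position i: the vertex l i drops out and the
  later vertices shift by one.\<close>

lemma singular_face_straight_simplex: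
  assumes "i \<le> Suc n"
  shows "singular_face (Suc n) i (straight_simplex (Suc n) l) = straight_simplex n (\<lambda>j. if j < i then l j else l (Suc j))"
proof -
  have "(\<Sum>j\<le>Suc n. simplical_face i x j *\<^sub>R l j) = (\<Sum>j\<le>n. x j *\<^sub>R (if j < i then l j else l (Suc j)))" for x
  proof -
    let ?f = "\<lambda>j. simplical_face i x j *\<^sub>R l j"
    have "{..Suc n} = {..<i} \<union> insert i (Suc ` {i..n})"
    proof (intro equalityI subsetI)
      fix j assume "j \<in> {..Suc n}"
      then show "j \<in> {..<i} \<union> insert i (Suc ` {i..n})"
        by (cases j) (auto simp: image_iff not_less)
    qed (use assms in auto)
    moreover have "(\<Sum>j\<in>{..<i} \<union> insert i (Suc ` {i..n}). ?f j) = (\<Sum>j<i. ?f j) + (\<Sum>j\<in>insert i (Suc ` {i..n}). ?f j)"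
      by (rule sum.union_disjoint) auto
    ultimately have "(\<Sum>j\<le>Suc n. ?f j) = (\<Sum>j<i. ?f j) + (\<Sum>j\<in>insert i (Suc ` {i..n}). ?f j)"
      by metis
    also have "(\<Sum>j\<in>insert i (Suc ` {i..n}). ?f j) = (\<Sum>j\<in>{i..n}. ?f (Suc j))"
    proof -
      have "?f i = 0" by (simp add: simplical_face_def)
      moreover have "(\<Sum>j\<in>Suc ` {i..n}. ?f j) = (\<Sum>j\<in>{i..n}. ?f (Suc j))"
        by (simp only: sum.reindex[OF inj_on_subset[OF inj_Suc subset_UNIV]] o_def)
      moreover have "(\<Sum>j\<in>insert i (Suc ` {i..n}). ?f j) = ?f i + (\<Sum>j\<in>Suc ` {i..n}. ?f j)"
        by (rule sum.insert) auto
      ultimately show ?thesis by (simp only: add_0)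
    qed
    also have "(\<Sum>j<i. ?f j) = (\<Sum>j<i. x j *\<^sub>R (if j < i then l j else l (Suc j)))"
      by (rule sum.cong) (auto simp: simplical_face_def)
    also have "(\<Sum>j\<in>{i..n}. ?f (Suc j)) = (\<Sum>j\<in>{i..n}. x j *\<^sub>R (if j < i then l j else l (Suc j)))"
      by (rule sum.cong) (auto simp: simplical_face_def)
    also have "(\<Sum>j<i. x j *\<^sub>R (if j < i then l j else l (Suc j))) + \<dots>
        = (\<Sum>j\<in>{..<i} \<union> {i..n}. x j *\<^sub>R (if j < i then l j else l (Suc j)))"
      by (rule sum.union_disjoint[symmetric]) auto
    also have "{..<i} \<union> {i..n} = {..n}" using assms by auto
    finally show ?thesis .
  qed
  moreover have "simplical_face i x \<in> standard_simplex (Suc n)" if "x \<in> standard_simplex n" for x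
    using simplical_face_in_standard_simplex[of "Suc n" i x] assms that by simp
  ultimately show ?thesis
    by (auto simp: singular_face_def straight_simplex_def restrict_def simp del: sum.atMost_Suc)
qed

lemma simplical_face_vertex:
  "simplical_face i (simplex_vertex j) = simplex_vertex (if j < i then j else Suc j)"
  by (auto simp: simplical_face_def fun_eq_iff)

lemma straight_simplex_cong: "(\<And>j. j \<le> n \<Longrightarrow> l j = l' j) \<Longrightarrow> straight_simplex n l = straight_simplex n l'"
  by (auto simp: straight_simplex_def intro!: restrict_ext)

text \<open>Only the vertices of the simplex pass through r, so a discontinuous choice of net points
  still yields a continuous simplex, compatibly with faces.\<close>

definition straighten :: "('e \<Rightarrow> 'e) \<Rightarrow> nat \<Rightarrow> ((nat \<Rightarrow> real) \<Rightarrow> 'e::real_normed_vector) \<Rightarrow> (nat \<Rightarrow> real) \<Rightarrow> 'e" where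
  "straighten r n \<sigma> = straight_simplex n (\<lambda>j. r (\<sigma> (simplex_vertex j)))"

lemma straighten_singular_face:
  assumes "i \<le> Suc n"
  shows "straighten r n (singular_face (Suc n) i \<sigma>) = singular_face (Suc n) i (straighten r (Suc n) \<sigma>)"
  unfolding straighten_def singular_face_straight_simplex[OF assms]
  by (rule straight_simplex_cong) (auto simp: singular_face_def simplical_face_vertex)

text \<open>The carrier is the convex hull of the \<delta>-neighbourhood of the image: it contains
  the simplex and the displaced vertices, and that of a face lies in that of the simplex.\<close>

lemma straighten_chain_homotopy:
  fixes r :: "'e::real_normed_vector \<Rightarrow> 'e"
  assumes "0 < \<delta>" and r: "\<And>x. dist x (r x) < \<delta>"
  obtains D where
    "\<And>n \<sigma>. singular_simplex n euclidean \<sigma> \<Longrightarrow>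
       singular_chain (Suc n) (top_of_set (convex hull (\<Union>x\<in>standard_simplex n. ball (\<sigma> x) \<delta>))) (D n \<sigma>)"
    "\<And>n \<sigma>. singular_simplex n euclidean \<sigma> \<Longrightarrow>
        chain_boundary (Suc n) (D n \<sigma>) + frag_extend (D (n - 1)) (chain_boundary n (frag_of \<sigma>))
          = frag_of (straighten r n \<sigma>) - frag_of \<sigma>"
proof -
  let ?C = "\<lambda>n \<sigma>. convex hull (\<Union>x\<in>standard_simplex n. ball (\<sigma> x) \<delta>)"
  have "\<exists>D. \<forall>n \<sigma>. singular_simplex n euclidean \<sigma> \<longrightarrow> singular_chain (Suc n) (top_of_set (?C n \<sigma>)) (D n \<sigma>) \<and>
        chain_boundary (Suc n) (D n \<sigma>) + frag_extend (D (n - 1)) (chain_boundary n (frag_of \<sigma>))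
          = frag_of (straighten r n \<sigma>) - frag_of \<sigma>"
  proof (rule convex_carrier_chain_homotopy[where C = ?C and T = "straighten r"])
    show "singular_simplex n (top_of_set (?C n \<sigma>)) \<sigma>" if "singular_simplex n euclidean \<sigma>" for n \<sigma>
    proof -
      have "\<sigma> x \<in> ?C n \<sigma>" if "x \<in> standard_simplex n" for x
        using that \<open>0 < \<delta>\<close> by (intro hull_inc UN_I[of x]) auto
      then show ?thesis using that by (auto simp: singular_simplex_subtopology)
    qed
    show "singular_simplex n (top_of_set (?C n \<sigma>)) (straighten r n \<sigma>)" for n and \<sigma> :: "(nat \<Rightarrow> real) \<Rightarrow> 'e"
      unfolding straighten_def
    proof (rule singular_simplex_straight_simplex)
      show "r (\<sigma> (simplex_vertex j)) \<in> ?C n \<sigma>" if "j \<le> n" for j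
        using that r by (intro hull_inc UN_I[of "simplex_vertex j"]) auto
    qed (rule convex_convex_hull)
    show "?C n (singular_face (Suc n) i \<sigma>) \<subseteq> ?C (Suc n) \<sigma>" if "i \<le> Suc n" for n i and \<sigma> :: "(nat \<Rightarrow> real) \<Rightarrow> 'e"
    proof (intro hull_mono UN_least)
      fix x assume x: "x \<in> standard_simplex n"
      then have "simplical_face i x \<in> standard_simplex (Suc n)"
        using simplical_face_in_standard_simplex[of "Suc n" i x] that by simp
      then show "ball (singular_face (Suc n) i \<sigma> x) \<delta> \<subseteq> (\<Union>x\<in>standard_simplex (Suc n). ball (\<sigma> x) \<delta>)"
        using x by (auto simp: singular_face_def)
    qed
  qed (rule convex_convex_hull straighten_singular_face, assumption?)+
  then show thesis using that by blast
qed

section \<open>Finiteness of persistent homology\<close>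

text \<open>Every simplex of the finite set has its own threshold, valid for all later subdivisions;
  the sum of the thresholds dominates each of them.\<close>

lemma small_subdivision_level_exists:
  assumes "\<And>U. U \<in> \<C> \<Longrightarrow> openin X U" "topspace X \<subseteq> \<Union>\<C>" "finite S"
    and "\<And>s. s \<in> S \<Longrightarrow> singular_simplex p X s"
  shows "\<exists>N. \<forall>s\<in>S. \<forall>t\<in>Poly_Mapping.keys ((singular_subdivision p ^^ N) (frag_of s)).
    \<exists>V\<in>\<C>. t \<in> standard_simplex p \<rightarrow> V"
proof -
  have "\<exists>n. \<forall>m t. n \<le> m \<longrightarrow> t \<in> Poly_Mapping.keys ((singular_subdivision p ^^ m) (frag_of s)) \<longrightarrow>
      (\<exists>V\<in>\<C>. t \<in> standard_simplex p \<rightarrow> V)" if "s \<in> S" for s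
  proof (rule sufficient_iterated_singular_subdivision_exists[of \<C> X p "frag_of s"])
    show "singular_chain p X (frag_of s)" using assms(4) that by (simp add: singular_chain_of)
  qed (use assms in blast)+
  then obtain n where n: "\<And>s m t. s \<in> S \<Longrightarrow> n s \<le> m \<Longrightarrow>
      t \<in> Poly_Mapping.keys ((singular_subdivision p ^^ m) (frag_of s)) \<Longrightarrow> \<exists>V\<in>\<C>. t \<in> standard_simplex p \<rightarrow> V"
    by metis
  have "n s \<le> sum n S" if "s \<in> S" for s using that assms(3) by (simp add: member_le_sum)
  then show ?thesis using n by (intro exI[of _ "sum n S"]) blast
qed

lemma subspace_field_chains: "fc.subspace (field_chains n X)"
  unfolding field_chains_def by (rule subspace_keys)

lemma field_chains_mono:
  "S \<subseteq> T \<Longrightarrow> field_chains n (subtopology X S) \<subseteq> field_chains n (subtopology X T)"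
  by (auto simp: field_chains_def subset_eq intro: singular_simplex_mono)

text \<open>Iterated subdivision is chain homotopic to the identity by a homotopy that stays in X.
  It is applied to the simplices of c one at a time and extended linearly.\<close>

lemma small_homologous_field_cycle_exists:
  assumes "\<And>U. U \<in> \<C> \<Longrightarrow> openin X U" "topspace X \<subseteq> \<Union>\<C>"
    and c: "c \<in> field_chains n X" "bd n c = 0"
  shows "\<exists>c'\<in>field_chains n X. \<exists>d\<in>field_chains (Suc n) X. bd n c' = 0 \<and> c' - c = bd (Suc n) d \<and>
    (\<forall>t\<in>Poly_Mapping.keys c'. \<exists>V\<in>\<C>. t \<in> standard_simplex n \<rightarrow> V)"
proof -
  note simplex = singular_simplex_of_field_chains[OF c(1)]
  have "\<exists>N. \<forall>s\<in>Poly_Mapping.keys c. \<forall>t\<in>Poly_Mapping.keys ((singular_subdivision n ^^ N) (frag_of s)).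
      \<exists>V\<in>\<C>. t \<in> standard_simplex n \<rightarrow> V"
    using assms(1,2) finite_keys simplex by (rule small_subdivision_level_exists)
  then obtain N where N: "\<And>s t. s \<in> Poly_Mapping.keys c \<Longrightarrow>
      t \<in> Poly_Mapping.keys ((singular_subdivision n ^^ N) (frag_of s)) \<Longrightarrow> \<exists>V\<in>\<C>. t \<in> standard_simplex n \<rightarrow> V"
    by blast
  obtain h where h: "\<And>p. h p 0 = (0 :: 'a chain)" "\<And>p c1 c2. h p (c1 - c2) = h p c1 - h p c2"
     "\<And>p X c. singular_chain p X c \<Longrightarrow> singular_chain (Suc p) X (h p c)"
     "\<And>p X c. singular_chain p X c \<Longrightarrow> chain_boundary (Suc p) (h p c) + h (p - Suc 0) (chain_boundary p c)
         = (singular_subdivision p ^^ N) c - c"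
    using chain_homotopic_iterated_singular_subdivision[of N] by blast
  define S where "S s = (singular_subdivision n ^^ N) (frag_of s)" for s :: "(nat \<Rightarrow> real) \<Rightarrow> 'a"
  define H where "H s = h n (frag_of s)" for s
  \<comment> \<open>For n = 0 the truncated index is harmless, since the boundary it acts on is
    zero.\<close>
  define H' where "H' s = h (n - Suc 0) (frag_of s)" for s
  have bd_H: "bd (Suc n) (field_extend H c) = field_extend S c - c"
  proof (rule bd_chain_homotopy[OF c(2)])
    fix s assume "s \<in> Poly_Mapping.keys c"
    then have "singular_chain n X (frag_of s)" using simplex by (simp add: singular_chain_of)
    moreover have "frag_extend H' (chain_boundary n (frag_of s)) = h (n - Suc 0) (chain_boundary n (frag_of s))"
      unfolding H'_def by (rule additive_eq_frag_extend[symmetric]) (rule h)+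
    ultimately show "chain_boundary (Suc n) (H s) + frag_extend H' (chain_boundary n (frag_of s)) = S s - frag_of s"
      using h(4) by (simp add: H_def S_def)
  qed
  have H: "field_extend H c \<in> field_chains (Suc n) X"
    using h(3) simplex by (intro field_extend_in_field_chains) (simp add: H_def singular_chain_of)
  show ?thesis
  proof (rule bexI[of _ "field_extend S c"], rule bexI[of _ "field_extend H c"], intro conjI ballI)
    have eq: "field_extend S c = c + bd (Suc n) (field_extend H c)" using bd_H by simp
    show "field_extend S c \<in> field_chains n X"
      unfolding eq using c(1) bd_in_field_chains[OF H] by (rule fc.subspace_add[OF subspace_field_chains])
    show "bd n (field_extend S c) = 0"
      unfolding eq using c(2) bd_bd[OF H] by (simp add: field_extend.add)
    show "\<exists>V\<in>\<C>. t \<in> standard_simplex n \<rightarrow> V" if t: "t \<in> Poly_Mapping.keys (field_extend S c)" for t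
    proof -
      obtain s where "s \<in> Poly_Mapping.keys c" "t \<in> Poly_Mapping.keys (S s)"
        using t keys_field_extend[of S c] by auto
      then show ?thesis using N by (simp add: S_def)
    qed
  qed (simp_all add: H bd_H)
qed

text \<open>Subdivision takes place inside A and straightening inside U, because straight simplices
  with vertices in A may leave A. G depends on the net and on n, not on the cycle.\<close>

lemma finite_chain_approximation:
  fixes A U :: "'e::euclidean_space set"
  assumes "compact A" "open U" "A \<subseteq> U"
  shows "\<exists>G. finite G \<and> (\<forall>c :: ('e, 'f::field) field_chain. c \<in> field_chains n (top_of_set A) \<and> bd n c = 0 \<longrightarrow>
    (\<exists>c' d. Poly_Mapping.keys c' \<subseteq> G \<and> d \<in> field_chains (Suc n) (top_of_set U) \<and> c' - c = bd (Suc n) d))"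
proof -
  obtain \<epsilon> where \<epsilon>: "0 < \<epsilon>" "(\<Union>x\<in>A. ball x \<epsilon>) \<subseteq> U"
    using compact_subset_open_imp_ball_epsilon_subset[OF assms] by blast
  \<comment> \<open>Half of \<epsilon> bounds the size of the subdivided simplices, the other half
    the displacement by straightening.\<close>
  define \<delta> where "\<delta> = \<epsilon> / 2"
  have "0 < \<delta>" using \<epsilon> by (simp add: \<delta>_def)
  obtain K where K: "finite K" "A \<subseteq> (\<Union>x\<in>K. ball x \<delta>)"
    using \<open>compact A\<close> \<open>0 < \<delta>\<close> unfolding compact_eq_totally_bounded by blast
  \<comment> \<open>Off A the map is the identity, so that the distance bound holds for every
    point.\<close>
  define r where "r x = (if x \<in> A then SOME y. y \<in> K \<and> dist x y < \<delta> else x)" for x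
  have rA: "r x \<in> K \<and> dist x (r x) < \<delta>" if x: "x \<in> A" for x
  proof -
    obtain y where "y \<in> K" "x \<in> ball y \<delta>" using K(2) x by blast
    then have "\<exists>y. y \<in> K \<and> dist x y < \<delta>" by (auto simp: dist_commute)
    then have "(SOME y. y \<in> K \<and> dist x y < \<delta>) \<in> K \<and> dist x (SOME y. y \<in> K \<and> dist x y < \<delta>) < \<delta>"
      by (rule someI_ex)
    then show ?thesis using x by (simp add: r_def)
  qed
  then have r: "dist x (r x) < \<delta>" for x using \<open>0 < \<delta>\<close> by (cases "x \<in> A") (auto simp: r_def)
  obtain D where D:
    "\<And>n \<sigma>. singular_simplex n euclidean \<sigma> \<Longrightarrow>
       singular_chain (Suc n) (top_of_set (convex hull (\<Union>x\<in>standard_simplex n. ball (\<sigma> x) \<delta>))) (D n \<sigma>)"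
    "\<And>n \<sigma>. singular_simplex n euclidean \<sigma> \<Longrightarrow>
        chain_boundary (Suc n) (D n \<sigma>) + frag_extend (D (n - 1)) (chain_boundary n (frag_of \<sigma>))
          = frag_of (straighten r n \<sigma>) - frag_of \<sigma>"
    using straighten_chain_homotopy[OF \<open>0 < \<delta>\<close> r] by blast
  \<comment> \<open>All straight simplices on the net; extensional vertex maps make the index set
    finite.\<close>
  define G where "G = straight_simplex n ` ({..n} \<rightarrow>\<^sub>E K)"
  show ?thesis
  proof (intro exI[of _ G] conjI allI impI)
    show "finite G" unfolding G_def using K(1) by (intro finite_imageI finite_PiE) auto
    fix c :: "('e, 'f) field_chain"
    assume "c \<in> field_chains n (top_of_set A) \<and> bd n c = 0"
    then have c: "c \<in> field_chains n (top_of_set A)" "bd n c = 0" by blast+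
    let ?C = "(\<lambda>x. A \<inter> ball x \<delta>) ` A"
    have "\<exists>c'\<in>field_chains n (top_of_set A). \<exists>d\<in>field_chains (Suc n) (top_of_set A). bd n c' = 0 \<and>
        c' - c = bd (Suc n) d \<and> (\<forall>t\<in>Poly_Mapping.keys c'. \<exists>V\<in>?C. t \<in> standard_simplex n \<rightarrow> V)"
    proof (rule small_homologous_field_cycle_exists)
      show "openin (top_of_set A) V" if "V \<in> ?C" for V using that by (auto simp: openin_open_Int)
      show "topspace (top_of_set A) \<subseteq> \<Union>?C" using \<open>0 < \<delta>\<close> by auto
    qed (fact c)+
    then obtain c1 d1 where c1: "c1 \<in> field_chains n (top_of_set A)" "bd n c1 = 0"
        "d1 \<in> field_chains (Suc n) (top_of_set A)" "c1 - c = bd (Suc n) d1"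
        "\<And>t. t \<in> Poly_Mapping.keys c1 \<Longrightarrow> \<exists>V\<in>?C. t \<in> standard_simplex n \<rightarrow> V"
      by blast
    note simplex = singular_simplex_of_field_chains[OF c1(1)]
    have simplex': "singular_simplex n euclidean s" "s ` standard_simplex n \<subseteq> A" if "s \<in> Poly_Mapping.keys c1" for s
      using simplex[OF that] by (simp_all add: singular_simplex_subtopology)
    define c2 :: "('e, 'f) field_chain" where "c2 = field_extend (\<lambda>s. frag_of (straighten r n s)) c1"
    define d2 :: "('e, 'f) field_chain" where "d2 = field_extend (D n) c1"
    have bd_d2: "bd (Suc n) d2 = c2 - c1"
      unfolding d2_def c2_def using D(2) simplex' by (intro bd_chain_homotopy[OF c1(2)]) blast
    have "straighten r n s \<in> G" if "s \<in> Poly_Mapping.keys c1" for s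
    proof -
      let ?l = "\<lambda>j\<in>{..n}. r (s (simplex_vertex j))"
      have "s (simplex_vertex j) \<in> A" if "j \<le> n" for j
        using simplex'(2)[OF \<open>s \<in> _\<close>] that by auto
      then have "?l \<in> {..n} \<rightarrow>\<^sub>E K" using rA by auto
      moreover have "straighten r n s = straight_simplex n ?l"
        unfolding straighten_def by (rule straight_simplex_cong) simp
      ultimately show ?thesis unfolding G_def by blast
    qed
    then have "Poly_Mapping.keys c2 \<subseteq> G"
      unfolding c2_def by (intro order_trans[OF keys_field_extend] UN_least) simp
    moreover have "d2 \<in> field_chains (Suc n) (top_of_set U)"
      unfolding d2_def
    proof (rule field_extend_in_field_chains)
      fix s assume s: "s \<in> Poly_Mapping.keys c1"
      obtain x where x: "x \<in> A" "s \<in> standard_simplex n \<rightarrow> ball x \<delta>" using c1(5)[OF s] by auto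
      have "ball (s y) \<delta> \<subseteq> ball x \<epsilon>" if "y \<in> standard_simplex n" for y
      proof
        fix z assume "z \<in> ball (s y) \<delta>"
        moreover have "dist x (s y) < \<delta>" using x(2) that by auto
        ultimately show "z \<in> ball x \<epsilon>"
          using dist_triangle[of x z "s y"] by (simp add: \<delta>_def)
      qed
      then have "convex hull (\<Union>x\<in>standard_simplex n. ball (s x) \<delta>) \<subseteq> ball x \<epsilon>"
        by (intro hull_minimal UN_least convex_ball)
      also have "\<dots> \<subseteq> U" using \<epsilon>(2) x(1) by blast
      finally show "singular_chain (Suc n) (top_of_set U) (D n s)"
        using D(1)[OF simplex'(1)[OF s]] by (rule singular_chain_mono[rotated])
    qed
    then have "d1 + d2 \<in> field_chains (Suc n) (top_of_set U)"
      using c1(3) field_chains_mono[OF \<open>A \<subseteq> U\<close>]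
      by (intro fc.subspace_add[OF subspace_field_chains]) auto
    moreover have "c2 - c = bd (Suc n) (d1 + d2)"
      using bd_d2 c1(4) by (simp add: field_extend.add flip: c1(4))
    ultimately show "\<exists>c' d. Poly_Mapping.keys c' \<subseteq> G \<and> d \<in> field_chains (Suc n) (top_of_set U) \<and> c' - c = bd (Suc n) d"
      by blast
  qed
qed

section \<open>Chain maps and transport along a retraction\<close>

abbreviation field_chain_map :: "nat \<Rightarrow> ('a \<Rightarrow> 'b) \<Rightarrow> ('a, 'f::field) field_chain \<Rightarrow> ('b, 'f) field_chain" where
  "field_chain_map n f \<equiv> field_extend (\<lambda>s. frag_of (simplex_map n f s))"

lemma field_chain_map_in_field_chains:
  assumes "c \<in> field_chains n X" "continuous_map X Y f"
  shows "field_chain_map n f c \<in> field_chains n Y"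
  using assms by (intro field_extend_in_field_chains)
    (auto simp: singular_chain_of intro: singular_simplex_simplex_map dest: singular_simplex_of_field_chains)

lemma bd_field_chain_map:
  assumes "c \<in> field_chains n X"
  shows "bd n (field_chain_map n f c) = field_chain_map (n - Suc 0) f (bd n c)"
  unfolding bd_field_extend field_extend_field_extend
proof (rule field_extend_cong)
  fix s assume "s \<in> Poly_Mapping.keys c"
  then have "singular_chain n X (frag_of s)"
    using assms by (simp add: singular_chain_of singular_simplex_of_field_chains)
  then have "chain_boundary n (chain_map n f (frag_of s)) = chain_map (n - Suc 0) f (chain_boundary n (frag_of s))"
    by (rule chain_boundary_chain_map)
  then show "chain_boundary n (frag_of (simplex_map n f s))
      = frag_extend (\<lambda>s. frag_of (simplex_map (n - Suc 0) f s)) (chain_boundary n (frag_of s))"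
    by (simp add: chain_map_def o_def)
qed

lemma field_chain_map_inverse:
  assumes "c \<in> field_chains n X" "\<And>x. x \<in> topspace X \<Longrightarrow> g (f x) = x"
  shows "field_chain_map n g (field_chain_map n f c) = c"
proof -
  have "field_chain_map n g (field_chain_map n f c) = field_extend frag_of c"
    unfolding field_extend_field_extend
  proof (rule field_extend_cong)
    fix s assume "s \<in> Poly_Mapping.keys c"
    then have "singular_simplex n X s" using assms by (simp add: singular_simplex_of_field_chains)
    then have "simplex_map n (g \<circ> f) s = s" using assms(2) by (intro simplex_map_id_gen) auto
    then show "frag_extend (\<lambda>s. frag_of (simplex_map n g s)) (frag_of (simplex_map n f s)) = frag_of s"
      by (simp add: simplex_map_compose)
  qed
  then show ?thesis by (simp add: field_extend_frag_of)
qed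

text \<open>Simplices are compact and convex, and a finite union of closed convex sets is a
  Euclidean neighbourhood retract.\<close>

lemma triangulable_imp_retract:
  assumes "triangulable TYPE('c::euclidean_space) X"
  obtains P U :: "'c::euclidean_space set" and f g r where "compact P" "open U" "P \<subseteq> U"
    "homeomorphic_maps X (top_of_set P) f g" "continuous_on U r" "r ` U \<subseteq> P" "\<And>x. x \<in> P \<Longrightarrow> r x = x"
proof -
  obtain \<K> :: "'c set set" where \<K>: "simplicial_complex \<K>" "X homeomorphic_space top_of_set (\<Union>\<K>)"
    using assms by (auto simp: triangulable_def)
  then obtain f g where fg: "homeomorphic_maps X (top_of_set (\<Union>\<K>)) f g"
    by (auto simp: homeomorphic_space_def)
  have fin: "finite \<K>" and simplices: "\<And>S. S \<in> \<K> \<Longrightarrow> \<exists>n. n simplex S"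
    using \<K>(1) by (auto simp: simplicial_complex_def)
  have S: "compact S" "convex S" if S: "S \<in> \<K>" for S
  proof -
    obtain C where "\<not> affine_dependent C" "S = convex hull C"
      using simplices[OF S] by (auto simp: simplex_def)
    then show "compact S" "convex S"
      by (simp_all add: aff_independent_finite finite_imp_compact_convex_hull)
  qed
  have "ENR (\<Union>\<K>)"
    using fin S by (intro ENR_finite_Union_convex_closed) (auto simp: compact_imp_closed)
  then obtain U where U: "open U" "\<Union>\<K> retract_of U" by (auto simp: ENR_def)
  then obtain r where r: "retraction U (\<Union>\<K>) r" by (auto simp: retract_of_def)
  show ?thesis
  proof (rule that[OF _ U(1) _ fg])
    show "compact (\<Union>\<K>)" using fin S(1) by (rule compact_Union)
    show "\<Union>\<K> \<subseteq> U" "continuous_on U r" "r ` U \<subseteq> \<Union>\<K>" "\<And>x. x \<in> \<Union>\<K> \<Longrightarrow> r x = x"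
      using r by (auto simp: retraction_def)
  qed
qed

text \<open>Tameness: the inclusion of a sublevel set into a strictly larger one factors, up to retraction,
  through an open neighbourhood of a compact subset of Euclidean space.\<close>

lemma sublevel_cycles_finite_mod_boundaries:
  assumes "triangulable TYPE('c::euclidean_space) X" "continuous_map X euclideanreal \<phi>" "u < v"
  shows "\<exists>F :: ('a, 'f::field) field_chain set. finite F \<and>
    {z \<in> field_chains n (sublevel X \<phi> u). bd n z = 0}
      \<subseteq> fc.span (F \<union> bd (Suc n) ` field_chains (Suc n) (sublevel X \<phi> v))"
proof -
  obtain P U :: "'c set" and f g r where P: "compact P" "open U" "P \<subseteq> U"
    "homeomorphic_maps X (top_of_set P) f g" "continuous_on U r" "r ` U \<subseteq> P" "\<And>x. x \<in> P \<Longrightarrow> r x = x"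
    using triangulable_imp_retract[OF assms(1)] by blast
  have f: "continuous_map X (top_of_set P) f" and g: "continuous_map (top_of_set P) X g"
    and gf: "\<And>x. x \<in> topspace X \<Longrightarrow> g (f x) = x"
    using P(4) by (auto simp: homeomorphic_maps_def)
  have "continuous_map (top_of_set P) euclideanreal (\<phi> \<circ> g)"
    using g assms(2) by (rule continuous_map_compose)
  then have \<phi>g: "continuous_on P (\<phi> \<circ> g)" by simp
  have rU: "continuous_map (top_of_set U) (top_of_set P) r"
    using P(5,6) by (auto simp: continuous_map_in_subtopology)
  then have gr: "continuous_map (top_of_set U) X (g \<circ> r)"
    using g by (rule continuous_map_compose)
  then have "continuous_map (top_of_set U) euclideanreal (\<phi> \<circ> (g \<circ> r))"
    using assms(2) by (rule continuous_map_compose)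
  then have \<phi>gr: "continuous_on U (\<phi> \<circ> (g \<circ> r))" by simp
  \<comment> \<open>A is the sublevel set at u, seen in P. W is open because it is cut out by a
    strict inequality for \<phi> extended along the retraction, and u < v places A inside
    it.\<close>
  define A where "A = P \<inter> (\<phi> \<circ> g) -` {..u}"
  define W where "W = U \<inter> (\<phi> \<circ> (g \<circ> r)) -` {..<v}"
  have "closed A" unfolding A_def
    using \<phi>g P(1) by (intro continuous_closed_preimage) (auto simp: compact_imp_closed)
  then have "compact A" using P(1) unfolding A_def by (metis compact_Int_closed inf.left_idem)
  moreover have "open W" unfolding W_def
    using \<phi>gr P(2) by (intro continuous_open_preimage) auto
  moreover have "A \<subseteq> W" using P(3,7) \<open>u < v\<close> by (auto simp: A_def W_def)
  ultimately have "\<exists>G. finite G \<and> (\<forall>c :: ('c, 'f) field_chain. c \<in> field_chains n (top_of_set A) \<and> bd n c = 0 \<longrightarrow>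
      (\<exists>c' d. Poly_Mapping.keys c' \<subseteq> G \<and> d \<in> field_chains (Suc n) (top_of_set W) \<and> c' - c = bd (Suc n) d))"
    by (rule finite_chain_approximation)
  then obtain G where G: "finite G"
    "\<And>c :: ('c, 'f) field_chain. c \<in> field_chains n (top_of_set A) \<Longrightarrow> bd n c = 0 \<Longrightarrow>
       \<exists>c' d. Poly_Mapping.keys c' \<subseteq> G \<and> d \<in> field_chains (Suc n) (top_of_set W) \<and> c' - c = bd (Suc n) d"
    by auto
  have fA: "continuous_map (sublevel X \<phi> u) (top_of_set A) f"
    using f gf continuous_map_image_subset_topspace[OF f] unfolding sublevel_def A_def
    by (auto simp: continuous_map_in_subtopology continuous_map_from_subtopology)
  have grW: "continuous_map (top_of_set W) (sublevel X \<phi> v) (g \<circ> r)"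
  proof -
    have "continuous_map (top_of_set W) X (g \<circ> r)"
      using gr unfolding W_def by (metis continuous_map_from_subtopology_mono inf_le1)
    then show ?thesis
      unfolding sublevel_def continuous_map_in_subtopology
      using continuous_map_image_subset_topspace[of "top_of_set W" X "g \<circ> r"] by (auto simp: W_def)
  qed
  \<comment> \<open>Members of F need not be chains of a sublevel set; F only has to be finite and
    to span the pushed-back approximations.\<close>
  define F :: "('a, 'f) field_chain set" where "F = (\<lambda>s. Poly_Mapping.single (simplex_map n (g \<circ> r) s) 1) ` G"
  let ?B = "bd (Suc n) ` field_chains (Suc n) (sublevel X \<phi> v)"
  have "z \<in> fc.span (F \<union> ?B)" if z: "z \<in> field_chains n (sublevel X \<phi> u)" "bd n z = 0"
    for z :: "('a, 'f) field_chain"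
  proof -
    let ?z = "field_chain_map n f z"
    have "?z \<in> field_chains n (top_of_set A)" using z(1) fA by (rule field_chain_map_in_field_chains)
    moreover have "bd n ?z = 0" using bd_field_chain_map[OF z(1)] z(2) by (simp add: field_extend.zero)
    ultimately obtain c d where c: "Poly_Mapping.keys c \<subseteq> G" "d \<in> field_chains (Suc n) (top_of_set W)"
       "c - ?z = bd (Suc n) d"
      using G(2) by blast
    let ?c = "field_chain_map n (g \<circ> r) c" and ?d = "field_chain_map (Suc n) (g \<circ> r) d"
    \<comment> \<open>Since g \<circ> r undoes f, pushing the approximated cycle back returns z
      itself up to a boundary at level v.\<close>
    have "(g \<circ> r) (f x) = x" if "x \<in> topspace (sublevel X \<phi> u)" for x
    proof -
      have "x \<in> topspace X" using that by (simp add: sublevel_def)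
      then have "f x \<in> P" using continuous_map_image_subset_topspace[OF f] by auto
      then show ?thesis using P(7) gf[OF \<open>x \<in> topspace X\<close>] by simp
    qed
    then have "field_chain_map n (g \<circ> r) ?z = z" by (rule field_chain_map_inverse[OF z(1)])
    then have "?c - z = field_chain_map n (g \<circ> r) (c - ?z)" by (simp add: field_extend.diff)
    also have "\<dots> = bd (Suc n) ?d" using bd_field_chain_map[OF c(2), of "g \<circ> r"] c(3) by simp
    finally have "?c - z = bd (Suc n) ?d" .
    then have z_eq: "z = ?c - bd (Suc n) ?d" by (simp flip: \<open>?c - z = bd (Suc n) ?d\<close>)
    have "?c \<in> fc.span F"
      unfolding field_extend_def of_chain_frag_of
      by (rule fc.span_sum, rule fc.span_scale, rule fc.span_base) (use c(1) in \<open>auto simp: F_def\<close>)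
    then have "?c \<in> fc.span (F \<union> ?B)" using fc.span_mono[of F "F \<union> ?B"] by blast
    moreover have "bd (Suc n) ?d \<in> fc.span (F \<union> ?B)"
      using field_chain_map_in_field_chains[OF c(2) grW] by (intro fc.span_base) blast
    ultimately have "?c - bd (Suc n) ?d \<in> fc.span (F \<union> ?B)" by (rule fc.span_diff)
    then show ?thesis by (subst z_eq)
  qed
  then show ?thesis using G(1) by (intro exI[of _ F]) (auto simp: F_def)
qed

section \<open>Persistent Betti numbers\<close>

abbreviation cycles :: "int \<Rightarrow> 'a topology \<Rightarrow> ('a, 'f::field) field_chain set" where
  "cycles k X \<equiv> carrier (field_cycle_space k X)"

lemma carrier_field_chain_space:
  "carrier (field_chain_space k X) = (if k < 0 then {0} else field_chains (nat k) X)"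
  by (auto simp: field_chain_space_def field_chains_def)

lemma cycles_eq:
  "cycles k X = (if k < 0 then {0} else {c \<in> field_chains (nat k) X. bd (nat k) c = 0})"
  by (auto simp: field_cycle_space_def carrier_field_chain_space field_boundary_eq field_extend.zero)

text \<open>At k = -1 the boundary of 0-chains is zero by definition: the homology is
  unreduced.\<close>

lemma field_boundaries_eq:
  "field_boundaries k X = (if k < 0 then {0} else bd (Suc (nat k)) ` field_chains (Suc (nat k)) X)"
proof (cases "k < 0")
  case True
  have "field_boundary (k + 1) c = 0" for c :: "('a, 'b) field_chain"
    using True by (simp add: field_boundary_def)
  moreover have "0 \<in> carrier (field_chain_space (k + 1) X)"
    by (simp add: carrier_field_chain_space fc.subspace_0[OF subspace_field_chains])
  ultimately show ?thesis using True by (auto simp: field_boundaries_def)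
next
  case False
  then have "nat (k + 1) = Suc (nat k)" by simp
  with False show ?thesis
    by (simp add: field_boundaries_def carrier_field_chain_space field_boundary_eq)
qed

lemma subspace_cycles: "fc.subspace (cycles k X :: ('a, 'f::field) field_chain set)"
proof (cases "k < 0")
  case True
  then show ?thesis by (simp add: cycles_eq fc.subspace_single_0)
next
  case False
  then have eq: "(cycles k X :: ('a, 'f) field_chain set) = field_chains (nat k) X \<inter> {c. bd (nat k) c = 0}"
    by (auto simp: cycles_eq)
  show ?thesis
    unfolding eq by (intro fc.subspace_inter subspace_field_chains field_extend.subspace_kernel)
qed

lemma subspace_field_boundaries: "fc.subspace (field_boundaries k X)"
  by (simp add: field_boundaries_eq fc.subspace_single_0 field_extend.subspace_image subspace_field_chains)

lemma field_chains_sublevel_mono: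
  "u \<le> v \<Longrightarrow> field_chains n (sublevel X \<phi> u) \<subseteq> field_chains n (sublevel X \<phi> v)"
  unfolding sublevel_def by (intro field_chains_mono) auto

lemma cycles_sublevel_mono: "u \<le> v \<Longrightarrow> cycles k (sublevel X \<phi> u) \<subseteq> cycles k (sublevel X \<phi> v)"
  using field_chains_sublevel_mono[of u v "nat k" X \<phi>] by (auto simp: cycles_eq)

lemma field_boundaries_sublevel_mono:
  "u \<le> v \<Longrightarrow> field_boundaries k (sublevel X \<phi> u) \<subseteq> field_boundaries k (sublevel X \<phi> v)"
  using field_chains_sublevel_mono[of u v "Suc (nat k)" X \<phi>] by (auto simp: field_boundaries_eq)

section \<open>Models of persistent homology\<close>

definition coset :: "'v::ab_group_add set \<Rightarrow> 'v \<Rightarrow> 'v set" where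
  "coset B z = (\<lambda>b. b + z) ` B"

lemma coset_eq_iff:
  assumes "fc.subspace B"
  shows "coset B x = coset B y \<longleftrightarrow> x - y \<in> B"
proof
  assume "coset B x = coset B y"
  then have "0 + x \<in> coset B y" using fc.subspace_0[OF assms] by (auto simp: coset_def)
  then show "x - y \<in> B" by (auto simp: coset_def)
next
  assume xy: "x - y \<in> B"
  have "b + x \<in> coset B y" "b + y \<in> coset B x" if "b \<in> B" for b
  proof -
    have "b + (x - y) \<in> B" "b - (x - y) \<in> B"
      using that xy assms by (auto intro: fc.subspace_add fc.subspace_diff)
    then show "b + x \<in> coset B y" "b + y \<in> coset B x"
      unfolding coset_def by (force simp: image_iff algebra_simps)+
  qed
  then show "coset B x = coset B y" by (auto simp: coset_def)
qed

text \<open>All cycle spaces share the addition of the chain type, so cosets depend neither on k nor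
  on X.\<close>

lemma a_r_coset_field_cycle_space: "B +>\<^bsub>field_cycle_space k X\<^esub> z = coset B z"
  by (auto simp: a_r_coset_def r_coset_def coset_def field_cycle_space_def field_chain_space_def)

text \<open>The induced map and the scalar multiplication are unions over representatives; all the
  cosets in such a union coincide.\<close>

lemma coset_UN:
  assumes "fc.subspace B" "\<And>b. b \<in> A \<Longrightarrow> g b - z \<in> B" "A \<noteq> {}"
  shows "(\<Union>b\<in>A. coset B (g b)) = coset B z"
proof -
  have "coset B (g b) = coset B z" if "b \<in> A" for b
    using assms(2)[OF that] by (simp add: coset_eq_iff[OF assms(1)])
  then show ?thesis using assms(3) by auto
qed

text \<open>An element of the persistent group is the coset, modulo boundaries at v, of a cycle at
  u. As q is idempotent with these boundaries as kernel, q x is a canonical representative of the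
  coset of x.\<close>

lemma persistent_homology_models:
  fixes q :: "('a, 'f::field) field_chain \<Rightarrow> ('a, 'f) field_chain"
  assumes "u < v"
    and lin: "Vector_Spaces.linear fscale fscale q"
    and ker: "\<And>x. q x = 0 \<longleftrightarrow> x \<in> field_boundaries k (sublevel X \<phi> v)"
    and proj: "\<And>x. x - q x \<in> field_boundaries k (sublevel X \<phi> v)"
  shows "models fscale (q ` cycles k (sublevel X \<phi> u)) (coset (field_boundaries k (sublevel X \<phi> v)))
    (persistent_homology TYPE('f) k X \<phi> u v)"
proof -
  interpret q: Vector_Spaces.linear fscale fscale q by fact
  let ?Z = "cycles k (sublevel X \<phi> u) :: ('a, 'f) field_chain set"
  let ?B = "field_boundaries k (sublevel X \<phi> u) :: ('a, 'f) field_chain set"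
  let ?B' = "field_boundaries k (sublevel X \<phi> v) :: ('a, 'f) field_chain set"
  let ?H = "persistent_homology TYPE('f) k X \<phi> u v"
  have B': "fc.subspace ?B'" by (rule subspace_field_boundaries)
  have BB': "?B \<subseteq> ?B'" using assms(1) by (intro field_boundaries_sublevel_mono) simp
  have coset_q: "coset ?B' (q x) = coset ?B' x" for x
    using proj[of x] by (metis coset_eq_iff[OF B'])
  have qq: "q (q x) = q x" for x
    using proj[of x] ker[of "x - q x"] by (simp add: q.diff)
  have carrier_H: "carrier ?H = coset ?B' ` ?Z"
  proof -
    have "carrier (field_homology k (sublevel X \<phi> u)) = coset ?B ` ?Z"
      by (auto simp: field_homology_def quotient_module_def A_RCOSETS_def RCOSETS_def
          a_r_coset_field_cycle_space[unfolded a_r_coset_def])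
    moreover have "homology_inclusion k (sublevel X \<phi> v) (coset ?B z) = coset ?B' z" for z
      unfolding homology_inclusion_def a_r_coset_field_cycle_space
    proof (rule coset_UN[OF B'])
      show "w - z \<in> ?B'" if "w \<in> coset ?B z" for w using that BB' by (auto simp: coset_def)
      show "coset ?B z \<noteq> {}"
        using fc.subspace_0[OF subspace_field_boundaries[of k "sublevel X \<phi> u"]] by (auto simp: coset_def)
    qed
    ultimately show ?thesis by (simp add: persistent_homology_def image_image)
  qed
  have zero_H: "\<zero>\<^bsub>?H\<^esub> = coset ?B' 0"
    by (simp add: persistent_homology_def field_homology_def quotient_module_def coset_def)
  have add_H: "coset ?B' x \<oplus>\<^bsub>?H\<^esub> coset ?B' y = coset ?B' (x + y)" for x y
  proof -
    have "coset ?B' x \<oplus>\<^bsub>?H\<^esub> coset ?B' y = (\<Union>w\<in>coset ?B' x. \<Union>w'\<in>coset ?B' y. {w + w'})"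
      by (simp add: persistent_homology_def field_homology_def quotient_module_def set_add_def set_mult_def
        field_cycle_space_def field_chain_space_def)
    also have "\<dots> = coset ?B' (x + y)"
    proof (intro equalityI subsetI)
      fix z assume "z \<in> (\<Union>w\<in>coset ?B' x. \<Union>w'\<in>coset ?B' y. {w + w'})"
      then obtain b b' where "b \<in> ?B'" "b' \<in> ?B'" "z = (b + b') + (x + y)"
        by (auto simp: coset_def algebra_simps)
      then show "z \<in> coset ?B' (x + y)" unfolding coset_def using fc.subspace_add[OF B'] by blast
    next
      fix z assume "z \<in> coset ?B' (x + y)"
      then obtain b where b: "b \<in> ?B'" "z = (b + x) + (0 + y)" by (auto simp: coset_def algebra_simps)
      moreover have "b + x \<in> coset ?B' x" "0 + y \<in> coset ?B' y"
        using b(1) fc.subspace_0[OF B'] unfolding coset_def by blast+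
      ultimately show "z \<in> (\<Union>w\<in>coset ?B' x. \<Union>w'\<in>coset ?B' y. {w + w'})" by blast
    qed
    finally show ?thesis .
  qed
  have smult_H: "a \<odot>\<^bsub>?H\<^esub> coset ?B' x = coset ?B' (fscale a x)" for a x
  proof -
    have "a \<odot>\<^bsub>?H\<^esub> coset ?B' x = (\<Union>w\<in>coset ?B' x. coset ?B' (fscale a w))"
      by (simp add: persistent_homology_def field_homology_def quotient_module_def
        a_r_coset_field_cycle_space) (simp add: field_cycle_space_def field_chain_space_def fscale_def)
    also have "\<dots> = coset ?B' (fscale a x)"
    proof (rule coset_UN[OF B'])
      show "fscale a w - fscale a x \<in> ?B'" if "w \<in> coset ?B' x" for w
        using that fc.subspace_scale[OF B'] by (auto simp: coset_def fc.scale_right_distrib)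
      show "coset ?B' x \<noteq> {}" using fc.subspace_0[OF B'] by (auto simp: coset_def)
    qed
    finally show ?thesis .
  qed
  show ?thesis
    unfolding models_def bij_betw_def
  proof (intro conjI ballI allI)
    show "inj_on (coset ?B') (q ` ?Z)"
    proof (rule inj_onI)
      fix x y assume "x \<in> q ` ?Z" "y \<in> q ` ?Z" "coset ?B' x = coset ?B' y"
      then have "q x = x" "q y = y" "q (x - y) = 0"
        using qq ker by (auto simp: coset_eq_iff[OF B'])
      then show "x = y" by (simp add: q.diff)
    qed
    show "coset ?B' ` q ` ?Z = carrier ?H" by (simp add: carrier_H image_image coset_q)
  qed (simp_all add: zero_H add_H smult_H)
qed

text \<open>\<open>q v\<close> projects chains along the boundaries at level \<open>v\<close>, so that all persistent homology groups
  become subspaces of one fixed vector space.\<close>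

definition homology_projections ::
  "int \<Rightarrow> 'a topology \<Rightarrow> ('a \<Rightarrow> real) \<Rightarrow> (real \<Rightarrow> ('a, 'f::field) field_chain \<Rightarrow> ('a, 'f) field_chain) \<Rightarrow> bool" where
  "homology_projections k X \<phi> q \<longleftrightarrow>
     (\<forall>v. Vector_Spaces.linear fscale fscale (q v)) \<and>
     (\<forall>v w x. v \<le> w \<longrightarrow> q w (q v x) = q w x) \<and>
     (\<forall>u v. u < v \<longrightarrow> (\<exists>h. models fscale (q v ` cycles k (sublevel X \<phi> u)) h (persistent_homology TYPE('f) k X \<phi> u v))) \<and>
     (\<forall>u v. u < v \<longrightarrow> (\<exists>F. finite F \<and> q v ` cycles k (sublevel X \<phi> u) \<subseteq> fc.span F))"

text \<open>The projections are chosen independently for each level. They are compatible for v \<le>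
  w because x - q v x is a boundary at v, hence at w, where q w kills it.\<close>

lemma homology_projections_exist:
  assumes "triangulable TYPE('c::euclidean_space) X" "continuous_map X euclideanreal \<phi>"
  shows "\<exists>q :: real \<Rightarrow> ('a, 'f::field) field_chain \<Rightarrow> ('a, 'f) field_chain. homology_projections k X \<phi> q"
proof -
  have "\<exists>q. Vector_Spaces.linear fscale fscale q \<and>
      (\<forall>x :: ('a, 'f) field_chain. q x = 0 \<longleftrightarrow> x \<in> field_boundaries k (sublevel X \<phi> v)) \<and>
      (\<forall>x. x - q x \<in> field_boundaries k (sublevel X \<phi> v))" for v
    by (rule fc.linear_projection_exists[OF subspace_field_boundaries]) blast
  then obtain q :: "real \<Rightarrow> ('a, 'f) field_chain \<Rightarrow> ('a, 'f) field_chain"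
    where lin: "\<And>v. Vector_Spaces.linear fscale fscale (q v)"
      and ker: "\<And>v x. q v x = 0 \<longleftrightarrow> x \<in> field_boundaries k (sublevel X \<phi> v)"
      and proj: "\<And>v x. x - q v x \<in> field_boundaries k (sublevel X \<phi> v)" by metis
  interpret q: Vector_Spaces.linear fscale fscale "q v" for v by (rule lin)
  show ?thesis
    unfolding homology_projections_def
  proof (intro exI[of _ q] conjI allI impI)
    show "q w (q v x) = q w x" if "v \<le> w" for v w x
    proof -
      have "x - q v x \<in> field_boundaries k (sublevel X \<phi> w)"
        using proj field_boundaries_sublevel_mono[OF that] by blast
      then have "q w (x - q v x) = 0" by (simp add: ker)
      then show ?thesis by (simp add: q.diff)
    qed
    show "\<exists>h. models fscale (q v ` cycles k (sublevel X \<phi> u)) h (persistent_homology TYPE('f) k X \<phi> u v)"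
      if "u < v" for u v
      using persistent_homology_models[OF that lin ker proj] by blast
    show "\<exists>F. finite F \<and> q v ` cycles k (sublevel X \<phi> u) \<subseteq> fc.span F" if "u < v" for u v
    proof -
      let ?B = "field_boundaries k (sublevel X \<phi> v) :: ('a, 'f) field_chain set"
      have "\<exists>F :: ('a, 'f) field_chain set. finite F \<and> cycles k (sublevel X \<phi> u) \<subseteq> fc.span (F \<union> ?B)"
      proof (cases "k < 0")
        case True
        then show ?thesis by (intro exI[of _ "{}"]) (simp add: cycles_eq fc.span_zero)
      next
        case False
        then show ?thesis
          using sublevel_cycles_finite_mod_boundaries[OF assms that, of "nat k"]
          by (simp add: cycles_eq field_boundaries_eq)
      qed
      then obtain F where F: "finite F" "cycles k (sublevel X \<phi> u) \<subseteq> fc.span (F \<union> ?B)" by blast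
      have "q v ` cycles k (sublevel X \<phi> u) \<subseteq> fc.span (q v ` (F \<union> ?B))"
        using F(2) by (metis q.span_image image_mono)
      \<comment> \<open>The boundaries at v become 0 under q v, so only the finite set F leaves
        generators.\<close>
      also have "\<dots> \<subseteq> fc.span (insert 0 (q v ` F))"
        using ker by (intro fc.span_mono) auto
      finally show ?thesis using F(1) by (intro exI[of _ "q v ` F"]) (simp add: fc.span_insert_0)
    qed
  qed (rule lin)
qed

lemma subspace_linear_image_cycles:
  assumes "Vector_Spaces.linear fscale fscale q"
  shows "fc.subspace (q ` cycles k X)"
proof -
  interpret q: Vector_Spaces.linear fscale fscale q by fact
  show ?thesis by (rule q.subspace_image[OF subspace_cycles])
qed

lemma field_chains_empty:
  assumes "topspace X = {}" shows "field_chains n X = {0}"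
proof -
  have eq: "singular_simplex_set n X = {}" using singular_simplex_empty[OF assms] by blast
  show ?thesis unfolding field_chains_def eq by auto
qed

text \<open>Raising v applies a further linear map to the model, and lowering u passes to a
  subspace; the inequalities are then those for dimensions of linear images. Vanishing holds below
  the minimum of \<phi>, where sublevel sets are empty.\<close>

lemma persistent_betti_function:
  assumes "triangulable TYPE('c::euclidean_space) X" "continuous_map X euclideanreal \<phi>"
  shows "betti_function (persistent_betti (persistent_homology TYPE('f::field) k X \<phi>))"
proof -
  let ?H = "persistent_homology TYPE('f) k X \<phi>"
  let ?Z = "\<lambda>u. cycles k (sublevel X \<phi> u) :: ('a, 'f) field_chain set"
  obtain q :: "real \<Rightarrow> ('a, 'f) field_chain \<Rightarrow> ('a, 'f) field_chain" where "homology_projections k X \<phi> q"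
    using homology_projections_exist[OF assms] by blast
  then have q: "\<And>v. Vector_Spaces.linear fscale fscale (q v)"
    "\<And>v w x. v \<le> w \<Longrightarrow> q w (q v x) = q w x"
    "\<And>u v. u < v \<Longrightarrow> \<exists>h. models fscale (q v ` ?Z u) h (?H u v)"
    "\<And>u v. u < v \<Longrightarrow> \<exists>F. finite F \<and> q v ` ?Z u \<subseteq> fc.span F"
    unfolding homology_projections_def by blast+
  have betti: "persistent_betti ?H u v = fc.dim (q v ` ?Z u)" if uv: "u < v" for u v
  proof -
    obtain h where h: "models fscale (q v ` ?Z u) h (?H u v)" using q(3)[OF uv] by blast
    obtain F where F: "finite F" "q v ` ?Z u \<subseteq> fc.span F" using q(4)[OF uv] by blast
    show ?thesis
      unfolding persistent_betti_def
      using subspace_linear_image_cycles[OF q(1)] h F(2,1) by (rule fc.models_imp_dim_eq)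
  qed
  have qq: "q w ` q v ` S = q w ` S" if "v \<le> w" for v w S
    using q(2)[OF that] by (simp add: image_image)
  show ?thesis
  proof
    fix u u' v' v :: real assume le: "u \<le> u'" "u' < v'" "v' \<le> v"
    obtain F where F: "finite F" "q v' ` ?Z u' \<subseteq> fc.span F" using q(4)[OF le(2)] by blast
    have sub: "q v' ` ?Z u \<subseteq> q v' ` ?Z u'" by (intro image_mono cycles_sublevel_mono le(1))
    have "fc.dim (q v ` q v' ` ?Z u) \<le> fc.dim (q v' ` ?Z u)"
      using q(1) order_trans[OF sub F(2)] F(1) by (rule fc.dim_linear_image_le)
    also have "\<dots> \<le> fc.dim (q v' ` ?Z u')" using sub F(2,1) by (rule fc.dim_mono_finite)
    finally show "persistent_betti ?H u v \<le> persistent_betti ?H u' v'"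
      using le by (simp add: betti qq)
  next
    fix u u' v v' :: real assume le: "u \<le> u'" "u' < v" "v \<le> v'"
    obtain F where F: "finite F" "q v ` ?Z u' \<subseteq> fc.span F" using q(4)[OF le(2)] by blast
    have sub: "q v ` ?Z u \<subseteq> q v ` ?Z u'" by (intro image_mono cycles_sublevel_mono le(1))
    have "fc.dim (q v' ` q v ` ?Z u') + fc.dim (q v ` ?Z u) \<le> fc.dim (q v' ` q v ` ?Z u) + fc.dim (q v ` ?Z u')"
      using q(1) sub F(2,1) by (rule fc.dim_linear_image_diff_le)
    then show "persistent_betti ?H u v + persistent_betti ?H u' v' \<le> persistent_betti ?H u' v + persistent_betti ?H u v'"
      using le by (simp add: betti qq)
  next
    \<comment> \<open>Compactness of the polyhedron bounds \<phi> from below.\<close>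
    have "compact_space X"
    proof -
      obtain P U :: "'c set" and f g r where P: "compact P" "open U" "P \<subseteq> U"
        "homeomorphic_maps X (top_of_set P) f g" "continuous_on U r" "r ` U \<subseteq> P" "\<And>x. x \<in> P \<Longrightarrow> r x = x"
        using triangulable_imp_retract[OF assms(1)] by blast
      have "X homeomorphic_space top_of_set P" using P(4) by (auto simp: homeomorphic_space_def)
      moreover have "compact_space (top_of_set P)" using P(1) by (intro compact_space_subtopology) simp
      ultimately show ?thesis by (simp add: homeomorphic_compact_space)
    qed
    then have "compactin euclideanreal (\<phi> ` topspace X)"
      using assms(2) by (metis compact_space_def image_compactin)
    then have "bounded (\<phi> ` topspace X)" by (simp add: compact_imp_bounded)
    then obtain l where l: "\<And>x. x \<in> topspace X \<Longrightarrow> l \<le> \<phi> x"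
      by (metis bounded_imp_bdd_below bdd_below.E imageI)
    have "persistent_betti ?H u v = 0" if "u < l" "u < v" for u v
    proof -
      have "topspace (sublevel X \<phi> u) = {}" using l \<open>u < l\<close> by (force simp: sublevel_def)
      then have "?Z u \<subseteq> {0}" by (auto simp: cycles_eq field_chains_empty)
      moreover interpret q: Vector_Spaces.linear fscale fscale "q v" by (rule q(1))
      have "q v 0 = 0" by (rule q.zero)
      ultimately have "q v ` ?Z u \<subseteq> fc.span {}" by auto
      then have "fc.dim (q v ` ?Z u) \<le> card ({} :: ('a, 'f) field_chain set)" by (rule fc.dim_le_card) simp
      then show ?thesis using that by (simp add: betti)
    qed
    then show "\<exists>l. \<forall>u<l. \<forall>v>u. persistent_betti ?H u v = 0" by blast
  qed
qed

text \<open>Betti numbers are the dimensions of the models, which lie in the chain spaces of X and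
  of Y; the dimension inequality yields a surjection between them.\<close>

lemma subgroup_surjects_persistent_homology:
  assumes "triangulable TYPE('c::euclidean_space) X" "triangulable TYPE('d::euclidean_space) Y"
    and "continuous_map X euclideanreal \<phi>" "continuous_map Y euclideanreal \<psi>"
    and "u < v" "u' < v'"
    and le: "persistent_betti (persistent_homology TYPE('f::field) k Y \<psi>) u' v'
      \<le> persistent_betti (persistent_homology TYPE('f) k X \<phi>) u v"
  shows "subgroup_surjects (persistent_homology TYPE('f) k X \<phi> u v) (persistent_homology TYPE('f) k Y \<psi> u' v')"
proof -
  obtain q :: "real \<Rightarrow> ('a, 'f) field_chain \<Rightarrow> ('a, 'f) field_chain" where "homology_projections k X \<phi> q"
    using homology_projections_exist[OF assms(1,3)] by blast
  then have q:
    "\<And>v. Vector_Spaces.linear fscale fscale (q v)" "\<And>v w x. v \<le> w \<Longrightarrow> q w (q v x) = q w x"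
    "\<And>u v. u < v \<Longrightarrow> \<exists>h. models fscale (q v ` cycles k (sublevel X \<phi> u)) h (persistent_homology TYPE('f) k X \<phi> u v)"
    "\<And>u v. u < v \<Longrightarrow> \<exists>F. finite F \<and> q v ` cycles k (sublevel X \<phi> u) \<subseteq> fc.span F"
    unfolding homology_projections_def by blast+
  obtain p :: "real \<Rightarrow> ('b, 'f) field_chain \<Rightarrow> ('b, 'f) field_chain" where "homology_projections k Y \<psi> p"
    using homology_projections_exist[OF assms(2,4)] by blast
  then have p:
    "\<And>v. Vector_Spaces.linear fscale fscale (p v)" "\<And>v w x. v \<le> w \<Longrightarrow> p w (p v x) = p w x"
    "\<And>u v. u < v \<Longrightarrow> \<exists>h. models fscale (p v ` cycles k (sublevel Y \<psi> u)) h (persistent_homology TYPE('f) k Y \<psi> u v)"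
    "\<And>u v. u < v \<Longrightarrow> \<exists>F. finite F \<and> p v ` cycles k (sublevel Y \<psi> u) \<subseteq> fc.span F"
    unfolding homology_projections_def by blast+
  let ?V = "persistent_homology TYPE('f) k X \<phi> u v" and ?W = "persistent_homology TYPE('f) k Y \<psi> u' v'"
  let ?U = "q v ` cycles k (sublevel X \<phi> u)" and ?U' = "p v' ` cycles k (sublevel Y \<psi> u')"
  have U: "fc.subspace ?U" "fc.subspace ?U'" using q(1) p(1) by (auto intro: subspace_linear_image_cycles)
  obtain h where h: "models fscale ?U h ?V" using q(3) \<open>u < v\<close> by blast
  obtain h' where h': "models fscale ?U' h' ?W" using p(3) \<open>u' < v'\<close> by blast
  obtain F where F: "?U \<subseteq> fc.span F" "finite F" using q(4) \<open>u < v\<close> by blast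
  obtain F' where F': "?U' \<subseteq> fc.span F'" "finite F'" using p(4) \<open>u' < v'\<close> by blast
  have "fc.dim ?U' \<le> fc.dim ?U"
    using le fc.models_imp_dim_eq[OF U(1) h F] fc.models_imp_dim_eq[OF U(2) h' F']
    by (simp add: persistent_betti_def)
  then show ?thesis by (rule fc_pair.subgroup_surjects_of_dim_le[OF U h h' F F'])
qed

text \<open>The cost is stated for f alone, while the second family of surjections needs it for the
  inverse bijection.\<close>

lemma displacement_commute: "displacement p q = displacement q p"
  by (cases "snd p"; cases "snd q") (auto simp: displacement_def abs_minus_commute)

lemma persistence_diagram_eq:
  assumes "betti_function (persistent_betti H)"
  shows "persistence_diagram H = betti_function.diagram (persistent_betti H)"
  by (simp add: persistence_diagram_def betti_function.diagram_def[OF assms])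

theorem theorem2p4:
  fixes X :: "'a topology" and Y :: "'b topology"
    and \<phi> :: "'a \<Rightarrow> real" and \<psi> :: "'b \<Rightarrow> real" and k :: int
  assumes "triangulable TYPE('c::euclidean_space) X"
    and "triangulable TYPE('d::euclidean_space) Y"
    and "continuous_map X euclideanreal \<phi>"
    and "continuous_map Y euclideanreal \<psi>"
  shows "d_T (persistent_homology TYPE('f::field) k X \<phi>) (persistent_homology TYPE('f) k Y \<psi>)
       \<le> d_match (persistence_diagram (persistent_homology TYPE('f) k X \<phi>))
                 (persistence_diagram (persistent_homology TYPE('f) k Y \<psi>))"
proof -
  let ?H = "persistent_homology TYPE('f) k X \<phi>" and ?K = "persistent_homology TYPE('f) k Y \<psi>"
  let ?D = "persistence_diagram ?H" and ?E = "persistence_diagram ?K"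
  have \<beta>: "betti_function (persistent_betti ?H)" and \<gamma>: "betti_function (persistent_betti ?K)"
    using assms by (auto intro: persistent_betti_function)
  note D = persistence_diagram_eq[OF \<beta>] and E = persistence_diagram_eq[OF \<gamma>]
  \<comment> \<open>It suffices to treat real upper bounds \<epsilon> of the cost; a bijection of
    infinite cost has none.\<close>
  have "d_T ?H ?K \<le> (SUP p\<in>?D. displacement (fst p) (fst (f p)))" if f: "bij_betw f ?D ?E" for f
  proof (rule ereal_le_real)
    fix \<epsilon> :: real
    assume "(SUP p\<in>?D. displacement (fst p) (fst (f p))) \<le> ereal \<epsilon>"
    then have disp: "displacement (fst p) (fst (f p)) \<le> ereal \<epsilon>" if "p \<in> ?D" for p
      using that by (simp add: SUP_le_iff)
    \<comment> \<open>Some diagonal point always belongs to the diagram, so a bound on the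
      displacements is nonnegative.\<close>
    have "((0, 0), 0) \<in> ?D" by (auto simp: persistence_diagram_def zero_ereal_def)
    from disp[OF this] have "0 \<le> \<epsilon>" by (auto simp: displacement_def)
    \<comment> \<open>The slack \<delta> makes the displacement bound strict; \<epsilon> + \<delta>
      is then admissible in \<open>d_T\<close> for every \<delta> > 0.\<close>
    show "d_T ?H ?K \<le> ereal \<epsilon>"
    proof (rule ereal_le_epsilon2)
      fix \<delta> :: real assume "0 < \<delta>"
      let ?\<epsilon> = "\<epsilon> + \<delta>"
      have less: "displacement (fst p) (fst (f p)) < ereal ?\<epsilon>" if "p \<in> ?D" for p
        using disp[OF that] by (rule order_le_less_trans) (use \<open>0 < \<delta>\<close> in simp)
      define g where "g = inv_into ?D f"
      have g: "bij_betw g ?E ?D" unfolding g_def using f by (rule bij_betw_inv_into)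
      have less': "displacement (fst p) (fst (g p)) < ereal ?\<epsilon>" if "p \<in> ?E" for p
        using less[of "g p"] bij_betwE[OF g] that f
        by (simp add: g_def displacement_commute[of "fst p"] bij_betw_inv_into_right)
      have "subgroup_surjects (?H u v) (?K (u - ?\<epsilon>) (v + ?\<epsilon>)) \<and> subgroup_surjects (?K u v) (?H (u - ?\<epsilon>) (v + ?\<epsilon>))"
        if "u < v" for u v
      proof
        have "persistent_betti ?K (u - ?\<epsilon>) (v + ?\<epsilon>) \<le> persistent_betti ?H u v"
          using g less' that \<open>0 \<le> \<epsilon>\<close> \<open>0 < \<delta>\<close> unfolding D E
          by (intro betti_le_of_diagram_injection[OF \<beta> \<gamma>, where g = g]) (auto simp: bij_betw_def)
        then show "subgroup_surjects (?H u v) (?K (u - ?\<epsilon>) (v + ?\<epsilon>))"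
          using that \<open>0 \<le> \<epsilon>\<close> \<open>0 < \<delta>\<close> by (intro subgroup_surjects_persistent_homology[OF assms]) auto
        have "persistent_betti ?H (u - ?\<epsilon>) (v + ?\<epsilon>) \<le> persistent_betti ?K u v"
          using f less that \<open>0 \<le> \<epsilon>\<close> \<open>0 < \<delta>\<close> unfolding D E
          by (intro betti_le_of_diagram_injection[OF \<gamma> \<beta>, where g = f]) (auto simp: bij_betw_def)
        then show "subgroup_surjects (?K u v) (?H (u - ?\<epsilon>) (v + ?\<epsilon>))"
          using that \<open>0 \<le> \<epsilon>\<close> \<open>0 < \<delta>\<close>
          by (intro subgroup_surjects_persistent_homology[OF assms(2,1,4,3)]) auto
      qed
      then have "d_T ?H ?K \<le> ereal ?\<epsilon>"
        unfolding d_T_def using \<open>0 \<le> \<epsilon>\<close> \<open>0 < \<delta>\<close> by (intro Inf_lower imageI) auto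
      then show "d_T ?H ?K \<le> ereal \<epsilon> + ereal \<delta>" by simp
    qed
  qed
  then show ?thesis unfolding d_match_def by (intro INF_greatest) simp
qed

end
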